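(* Let $X,Y$ be infinite-dimensional complex Hilbert spaces, let $W\in\mathcal{B}(Y,X)\setminus\{0\}$, let $A\in\mathcal{B}(X,Y)$ be $W$g-Drazin invertible and let $B\in\mathcal{B}(X,Y)$. Then the following statements are equivalent: (i) $A\leq^{\otimes,W,r}B$; (ii) $AW(AW)^{\otimes}=BW(AW)^{\otimes}$ and $(AW)^{\otimes}AW=(AW)^{\otimes}BW$; (iii) the following matrix representations with respect to the orthogonal sums $X=R((WA)^d)\oplus N[((WA)^d)^*]$ and $Y=R((AW)^d)\oplus N[((AW)^d)^*]$ hold: $$A=\begin{bmatrix}A_1&A_2\\0&A_3\end{bmatrix},\quad W=\begin{bmatrix}W_1&W_2\\0&W_3\end{bmatrix},\quad B=\begin{bmatrix}A_1&B_2\\0&B_3\end{bmatrix},$$ where $A_1\in\mathcal{B}(R((WA)^d),R((AW)^d))$ and $W_1\in\mathcal{B}(R((AW)^d),R((WA)^d))$ are invertible, $(A_2-B_2)W_3+(A_1W_1)^{-1}(A_1W_2+A_2W_3)(A_3-B_3)W_3=0$, and $A_3W_3\in\mathcal{B}(N[((AW)^d)^*])$ and $W_3A_3\in\mathcal{B}(N[((WA)^d)^*])$ are quasinilpotent.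
   Context: $\mathcal{B}(X,Y)$ is the set of bounded linear operators from $X$ to $Y$, $\mathcal{B}(X)=\mathcal{B}(X,X)$; $R(\cdot)$, $N(\cdot)$, $(\cdot)^*$ denote range, null space and adjoint; $P_L$ is the orthogonal projector onto a closed subspace $L$. An operator $T\in\mathcal{B}(X)$ is generalized Drazin invertible if there is a (necessarily unique) $T^d\in\mathcal{B}(X)$ with $TT^d=T^dT$, $T^dTT^d=T^d$ and $T-T^2T^d$ quasinilpotent (and similarly on $Y$). For $W\in\mathcal{B}(Y,X)\setminus\{0\}$, an operator $A\in\mathcal{B}(X,Y)$ is $W$g-Drazin invertible if there is a (necessarily unique) $A^{d,W}=B\in\mathcal{B}(X,Y)$ with $AWB=BWA$, $BWAWB=B$ and $A-AWBWA$ quasinilpotent in the weighted sense, i.e. $(A-AWBWA)W$ is a quasinilpotent operator on $Y$. In that case $AW$ and $WA$ are generalized Drazin invertible with $(AW)^d=A^{d,W}W$ and $(WA)^d=WA^{d,W}$. For a generalized Drazin invertible operator $T$ on a Hilbert space, the core-EP inverse $T^{\mathrm{cEP}}$ is the unique (it exists) operator $B$ with $TB=P_{R(T^d)}$ and $R(B)\subseteq R(T^d)$, and the weak group inverse of $T$ is $T^{\otimes}=(T^{\mathrm{cEP}})^2T$. Weak group relation: for $T$ generalized Drazin invertible and $S$ bounded on the same Hilbert space, $T\leq^{\otimes}S$ means $TT^{\otimes}=ST^{\otimes}$ and $T^{\otimes}T=T^{\otimes}S$. For $A,B\in\mathcal{B}(X,Y)$ with $A$ $W$g-Drazin invertible,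 $A\leq^{\otimes,W,r}B$ means $AW\leq^{\otimes}BW$. *)

theory Defs
  imports "HOL-Analysis.Analysis"
begin

section \<open>Complex Hilbert spaces\<close>

text \<open>
  The libraries used here only have real inner product spaces. A complex Hilbert space is a complete
  \<^class>\<open>real_inner\<close> space with a complex scalar multiplication extending the real one and a
  sesquilinear (linear in the first argument), Hermitian form whose real part is the real inner
  product. Hence \<open>cinner x x\<close> is real and equal to \<open>(norm x)^2\<close>, and the norm and topology
  are those of the complex inner product.
\<close>

class complex_inner = real_inner +
  fixes scaleC :: "complex \<Rightarrow> 'a \<Rightarrow> 'a" (infixr "*\<^sub>C" 75)
    and cinner :: "'a \<Rightarrow> 'a \<Rightarrow> complex"
  assumes scaleC_add_right: "a *\<^sub>C (x + y) = a *\<^sub>C x + a *\<^sub>C y"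
    and scaleC_add_left: "(a + b) *\<^sub>C x = a *\<^sub>C x + b *\<^sub>C x"
    and scaleC_scaleC: "a *\<^sub>C (b *\<^sub>C x) = (a * b) *\<^sub>C x"
    and scaleC_of_real: "complex_of_real r *\<^sub>C x = r *\<^sub>R x"
    and cinner_commute: "cinner x y = cnj (cinner y x)"
    and cinner_add_left: "cinner (x + y) z = cinner x z + cinner y z"
    and cinner_scaleC_left: "cinner (a *\<^sub>C x) y = a * cinner x y"
    and inner_eq_Re_cinner: "inner x y = Re (cinner x y)"

class chilbert_space = complex_inner + complete_space

global_interpretation complex_vector:
  vector_space "scaleC :: complex \<Rightarrow> 'a \<Rightarrow> 'a :: complex_inner"
proof
  show "1 *\<^sub>C x = x" for x :: 'a
    using scaleC_of_real[of 1 x] by simp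
qed (simp_all add: scaleC_add_right scaleC_add_left scaleC_scaleC)


section \<open>Bounded operators\<close>

text \<open>
  Operators between complex subspaces \<open>L\<close> and \<open>M\<close> are represented by total functions of which only
  the values on \<open>L\<close> matter; the space \<open>\<B>(X, Y)\<close> of operators between the whole spaces is
  \<open>bop UNIV UNIV\<close>, where function equality is equality of operators.
\<close>

definition bop :: "'a::complex_inner set \<Rightarrow> 'b::complex_inner set \<Rightarrow> ('a \<Rightarrow> 'b) set" where
  "bop L M = {f. (\<forall>x\<in>L. f x \<in> M) \<and>
                 (\<forall>x\<in>L. \<forall>y\<in>L. f (x + y) = f x + f y) \<and>
                 (\<forall>c. \<forall>x\<in>L. f (c *\<^sub>C x) = c *\<^sub>C f x) \<and>
                 (\<exists>K. \<forall>x\<in>L. norm (f x) \<le> K * norm x)}"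

definition invertible_op :: "'a::complex_inner set \<Rightarrow> 'b::complex_inner set \<Rightarrow> ('a \<Rightarrow> 'b) \<Rightarrow> bool" where
  "invertible_op L M f \<longleftrightarrow> f \<in> bop L M \<and>
     (\<exists>g \<in> bop M L. (\<forall>x\<in>L. g (f x) = x) \<and> (\<forall>y\<in>M. f (g y) = y))"

definition spectrum :: "'a::complex_inner set \<Rightarrow> ('a \<Rightarrow> 'a) \<Rightarrow> complex set" where
  "spectrum L T = {c. \<not> invertible_op L L (\<lambda>x. c *\<^sub>C x - T x)}"

text \<open>
  For closed subspaces \<open>L\<close>, the inclusion in place of \<open>spectrum L T = {0}\<close> only matters for
  \<open>L = {0}\<close>, where the spectrum is
  empty; the zero operator on the zero space counts as quasinilpotent.
\<close>

definition quasinilpotent :: "'a::complex_inner set \<Rightarrow> ('a \<Rightarrow> 'a) \<Rightarrow> bool" where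
  "quasinilpotent L T \<longleftrightarrow> T \<in> bop L L \<and> spectrum L T \<subseteq> {0}"

definition null_space :: "('a \<Rightarrow> 'b::zero) \<Rightarrow> 'a set" where
  "null_space f = {x. f x = 0}"

definition cadjoint :: "('a::chilbert_space \<Rightarrow> 'b::chilbert_space) \<Rightarrow> 'b \<Rightarrow> 'a" where
  "cadjoint f = (THE g. \<forall>x y. cinner (f x) y = cinner x (g y))"

definition orth_proj :: "'a::chilbert_space set \<Rightarrow> 'a \<Rightarrow> 'a" where
  "orth_proj L x = (THE p. p \<in> L \<and> (\<forall>y\<in>L. cinner (x - p) y = 0))"


section \<open>Generalized inverses\<close>

definition is_gdrazin_inverse ::
    "('a::chilbert_space \<Rightarrow> 'a) \<Rightarrow> ('a \<Rightarrow> 'a) \<Rightarrow> bool" where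
  "is_gdrazin_inverse T S \<longleftrightarrow> S \<in> bop UNIV UNIV \<and>
     T \<circ> S = S \<circ> T \<and> S \<circ> T \<circ> S = S \<and>
     quasinilpotent UNIV (\<lambda>x. T x - T (T (S x)))"

definition gdrazin_invertible :: "('a::chilbert_space \<Rightarrow> 'a) \<Rightarrow> bool" where
  "gdrazin_invertible T \<longleftrightarrow> T \<in> bop UNIV UNIV \<and> (\<exists>S. is_gdrazin_inverse T S)"

definition gdrazin :: "('a::chilbert_space \<Rightarrow> 'a) \<Rightarrow> 'a \<Rightarrow> 'a" where
  "gdrazin T = (THE S. is_gdrazin_inverse T S)"

text \<open>Here \<open>A : X \<rightarrow> Y\<close> and \<open>W : Y \<rightarrow> X\<close>.\<close>

definition is_wgdrazin_inverse ::
    "('y::chilbert_space \<Rightarrow> 'x::chilbert_space) \<Rightarrow> ('x \<Rightarrow> 'y) \<Rightarrow> ('x \<Rightarrow> 'y) \<Rightarrow> bool" where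
  "is_wgdrazin_inverse W A B \<longleftrightarrow> B \<in> bop UNIV UNIV \<and>
     A \<circ> W \<circ> B = B \<circ> W \<circ> A \<and> B \<circ> W \<circ> A \<circ> W \<circ> B = B \<and>
     quasinilpotent UNIV ((\<lambda>x. A x - (A \<circ> W \<circ> B \<circ> W \<circ> A) x) \<circ> W)"

definition wgdrazin_invertible ::
    "('y::chilbert_space \<Rightarrow> 'x::chilbert_space) \<Rightarrow> ('x \<Rightarrow> 'y) \<Rightarrow> bool" where
  "wgdrazin_invertible W A \<longleftrightarrow> A \<in> bop UNIV UNIV \<and> (\<exists>B. is_wgdrazin_inverse W A B)"

definition core_EP :: "('a::chilbert_space \<Rightarrow> 'a) \<Rightarrow> 'a \<Rightarrow> 'a" where
  "core_EP T = (THE B. B \<in> bop UNIV UNIV \<and> T \<circ> B = orth_proj (range (gdrazin T)) \<and>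
                       range B \<subseteq> range (gdrazin T))"

definition weak_group :: "('a::chilbert_space \<Rightarrow> 'a) \<Rightarrow> 'a \<Rightarrow> 'a" where
  "weak_group T = core_EP T \<circ> core_EP T \<circ> T"

definition weak_group_rel :: "('a::chilbert_space \<Rightarrow> 'a) \<Rightarrow> ('a \<Rightarrow> 'a) \<Rightarrow> bool" where
  "weak_group_rel T S \<longleftrightarrow> gdrazin_invertible T \<and> S \<in> bop UNIV UNIV \<and>
     T \<circ> weak_group T = S \<circ> weak_group T \<and> weak_group T \<circ> T = weak_group T \<circ> S"

definition weak_group_rel_r ::
    "('y::chilbert_space \<Rightarrow> 'x::chilbert_space) \<Rightarrow> ('x \<Rightarrow> 'y) \<Rightarrow> ('x \<Rightarrow> 'y) \<Rightarrow> bool" where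
  "weak_group_rel_r W A B \<longleftrightarrow> wgdrazin_invertible W A \<and> B \<in> bop UNIV UNIV \<and>
     weak_group_rel (A \<circ> W) (B \<circ> W)"


section \<open>Operator matrices\<close>

definition orth_sum :: "'a::chilbert_space set \<Rightarrow> 'a set \<Rightarrow> bool" where
  "orth_sum L M \<longleftrightarrow> complex_vector.subspace L \<and> closed L \<and>
     complex_vector.subspace M \<and> closed M \<and>
     (\<forall>x\<in>L. \<forall>y\<in>M. cinner x y = 0) \<and> (\<forall>z. \<exists>x\<in>L. \<exists>y\<in>M. z = x + y)"

text \<open>
  \<open>T\<close> has the operator matrix with rows \<open>(T11, T12)\<close> and \<open>(T21, T22)\<close> with respect to the orthogonal
  sums of \<open>L1\<close>, \<open>L2\<close> in the domain and of \<open>M1\<close>, \<open>M2\<close> in the codomain.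
\<close>

definition block_matrix ::
    "'a::chilbert_space set \<Rightarrow> 'a set \<Rightarrow> 'b::chilbert_space set \<Rightarrow> 'b set \<Rightarrow> ('a \<Rightarrow> 'b) \<Rightarrow>
     ('a \<Rightarrow> 'b) \<Rightarrow> ('a \<Rightarrow> 'b) \<Rightarrow> ('a \<Rightarrow> 'b) \<Rightarrow> ('a \<Rightarrow> 'b) \<Rightarrow> bool" where
  "block_matrix L1 L2 M1 M2 T T11 T12 T21 T22 \<longleftrightarrow>
     orth_sum L1 L2 \<and> orth_sum M1 M2 \<and>
     T11 \<in> bop L1 M1 \<and> T12 \<in> bop L2 M1 \<and> T21 \<in> bop L1 M2 \<and> T22 \<in> bop L2 M2 \<and>
     (\<forall>x1\<in>L1. \<forall>x2\<in>L2. T (x1 + x2) = (T11 x1 + T12 x2) + (T21 x1 + T22 x2))"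

end

theory Submission
  imports Defs "HOL-Complex_Analysis.Cauchy_Integral_Formula"
begin

text \<open>
  Let \<open>D\<close> be the weighted inverse of \<open>A\<close>, so that \<open>T = A W\<close> has generalized Drazin inverse
  \<open>S = D W\<close>, and let \<open>p\<close> be the orthogonal projection onto \<open>M = R(S)\<close>. Since \<open>S\<close> inverts \<open>T\<close> on \<open>M\<close>,
  the core-EP inverse is \<open>S p\<close> and the weak group inverse is \<open>S\<^sup>2 p T\<close>. With \<open>U = B W\<close>, the first
  equation of the weak group relation says \<open>U = T\<close> on \<open>M\<close>, that is, \<open>B\<close> and \<open>A\<close> have the same first
  column. Given this, the second one says \<open>p T (T - U) = 0\<close> on the orthogonal complement of \<open>M\<close>,
  which is the stated equation between the entries multiplied by \<open>A\<^sub>1 W\<^sub>1\<close>.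

  The triangular form of \<open>A\<close> and \<open>W\<close> holds for every \<open>A\<close>: the inverses of \<open>A\<^sub>1\<close> and \<open>W\<^sub>1\<close> are the
  restrictions of \<open>W D W\<close> and \<open>A W D\<close>, and quasinilpotency of \<open>T (1 - S T)\<close> passes to its
  compression \<open>A\<^sub>3 W\<^sub>3\<close>.
\<close>

section \<open>Complex inner products\<close>

lemma cinner_self: "cinner x x = complex_of_real ((norm x)\<^sup>2)"
proof (rule complex_eqI)
  show "Im (cinner x x) = Im (complex_of_real ((norm x)\<^sup>2))"
    using arg_cong[OF cinner_commute[of x x], of Im] by simp
qed (simp add: inner_eq_Re_cinner[symmetric] power2_norm_eq_inner)

lemma cinner_add_right: "cinner x (y + z) = cinner x y + cinner x z"
  by (simp only: cinner_commute[of x] cinner_add_left complex_cnj_add)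

lemma cinner_scaleC_right: "cinner x (c *\<^sub>C y) = cnj c * cinner x y"
  by (simp only: cinner_commute[of x] cinner_scaleC_left complex_cnj_mult)

lemma cinner_zero_left [simp]: "cinner 0 y = 0"
  using cinner_add_left[of 0 0 y] by simp

lemma cinner_zero_right [simp]: "cinner x 0 = 0"
  using cinner_add_right[of x 0 0] by simp

lemma cinner_diff_left: "cinner (x - y) z = cinner x z - cinner y z"
  using cinner_add_left[of "x - y" y z] by (simp add: algebra_simps)

lemma cinner_diff_right: "cinner x (y - z) = cinner x y - cinner x z"
  using cinner_add_right[of x "y - z" z] by (simp add: algebra_simps)

lemma cinner_self_eq_0 [simp]: "cinner x x = 0 \<longleftrightarrow> x = 0"
  by (simp add: cinner_self)

lemma cinner_eq_zero_commute: "cinner x y = 0 \<longleftrightarrow> cinner y x = 0"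
  using cinner_commute[of x y] cinner_commute[of y x] by auto

text \<open>The class ties the norm to the real inner product only; complex homogeneity comes from
  sesquilinearity together with \<open>c * cnj c = |c|^2\<close>.\<close>

lemma norm_scaleC: "norm (c *\<^sub>C x) = cmod c * norm x"
proof -
  have "complex_of_real ((norm (c *\<^sub>C x))\<^sup>2) = (c * cnj c) * complex_of_real ((norm x)\<^sup>2)"
    by (simp only: cinner_self[symmetric] cinner_scaleC_left cinner_scaleC_right mult_ac)
  also have "\<dots> = complex_of_real ((cmod c * norm x)\<^sup>2)"
    by (simp add: complex_norm_square power_mult_distrib flip: of_real_power)
  finally have "(norm (c *\<^sub>C x))\<^sup>2 = (cmod c * norm x)\<^sup>2"
    by (simp only: of_real_eq_iff)
  then show ?thesis
    by (rule power2_eq_imp_eq) auto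
qed

text \<open>Conjugate linearity in the second argument turns the real part at
  \<open>\<i> *\<^sub>C y\<close> into the imaginary part at \<open>y\<close>. Hence real
  orthogonality to a complex subspace, which is closed under multiplication by \<open>\<i>\<close>,
  is complex orthogonality.\<close>

lemma cinner_eq_inner: "cinner x y = Complex (inner x y) (inner x (\<i> *\<^sub>C y))"
  by (simp add: complex_eq_iff inner_eq_Re_cinner cinner_scaleC_right)

text \<open>The factor 2 arises from applying the real Cauchy-Schwarz inequality to the real and
  imaginary parts separately. The bound serves continuity and decay estimates, where the constant is
  immaterial.\<close>

lemma norm_cinner_le: "cmod (cinner x y) \<le> 2 * (norm x * norm y)"
proof -
  have "cmod (cinner x y) \<le> \<bar>inner x y\<bar> + \<bar>inner x (\<i> *\<^sub>C y)\<bar>"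
    unfolding cinner_eq_inner using cmod_le by (metis complex.sel)
  also have "\<dots> \<le> norm x * norm y + norm x * norm (\<i> *\<^sub>C y)"
    by (intro add_mono Cauchy_Schwarz_ineq2)
  finally show ?thesis
    by (simp add: norm_scaleC)
qed

lemma scaleC_zero_left: "0 *\<^sub>C x = 0"
  by (rule complex_vector.scale_zero_left)

lemma scaleC_zero_right: "c *\<^sub>C 0 = 0"
  by (rule complex_vector.scale_zero_right)

lemma scaleC_one: "1 *\<^sub>C x = x"
  by (rule complex_vector.scale_one)

lemma scaleC_diff_right: "c *\<^sub>C (x - y) = c *\<^sub>C x - c *\<^sub>C y"
  by (rule complex_vector.scale_right_diff_distrib)

lemma scaleC_diff_left: "(c - d) *\<^sub>C x = c *\<^sub>C x - d *\<^sub>C x"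
  by (rule complex_vector.scale_left_diff_distrib)


section \<open>Bounded operators\<close>

lemma bop_in: "f \<in> bop L M \<Longrightarrow> x \<in> L \<Longrightarrow> f x \<in> M"
  by (simp add: bop_def)

lemma bop_add: "f \<in> bop L M \<Longrightarrow> x \<in> L \<Longrightarrow> y \<in> L \<Longrightarrow> f (x + y) = f x + f y"
  by (simp add: bop_def)

lemma bop_scaleC: "f \<in> bop L M \<Longrightarrow> x \<in> L \<Longrightarrow> f (c *\<^sub>C x) = c *\<^sub>C f x"
  by (simp add: bop_def)

lemma bop_zero: "f \<in> bop L M \<Longrightarrow> 0 \<in> L \<Longrightarrow> f 0 = 0"
  using bop_scaleC[of f L M 0 0] by (simp only: scaleC_zero_left)

lemma bop_diff: "f \<in> bop UNIV M \<Longrightarrow> f (x - y) = f x - f y"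
  using bop_add[of f UNIV M "x - y" y] by (simp add: algebra_simps)

lemma bop_bound:
  assumes "f \<in> bop L M"
  obtains K where "K > 0" "\<And>x. x \<in> L \<Longrightarrow> norm (f x) \<le> K * norm x"
proof -
  obtain K where K: "\<And>x. x \<in> L \<Longrightarrow> norm (f x) \<le> K * norm x"
    using assms unfolding bop_def by blast
  have "norm (f x) \<le> (\<bar>K\<bar> + 1) * norm x" if "x \<in> L" for x
    using K[OF that] by (smt (verit) mult_right_mono norm_ge_zero)
  then show ?thesis
    by (intro that[of "\<bar>K\<bar> + 1"]) auto
qed

lemma bop_bounded_linear: "f \<in> bop UNIV M \<Longrightarrow> bounded_linear f"
proof -
  assume f: "f \<in> bop UNIV M"
  obtain K where "\<And>x. norm (f x) \<le> K * norm x"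
    by (rule bop_bound[OF f]) blast
  then show ?thesis
    using f by (intro bounded_linear_intro[where K = K])
      (auto simp: bop_add mult.commute bop_scaleC simp flip: scaleC_of_real)
qed

lemma bopI:
  assumes "\<And>x. x \<in> L \<Longrightarrow> f x \<in> M"
    and "\<And>x y. x \<in> L \<Longrightarrow> y \<in> L \<Longrightarrow> f (x + y) = f x + f y"
    and "\<And>c x. x \<in> L \<Longrightarrow> f (c *\<^sub>C x) = c *\<^sub>C f x"
    and "\<And>x. x \<in> L \<Longrightarrow> norm (f x) \<le> K * norm x"
  shows "f \<in> bop L M"
  using assms unfolding bop_def by blast

lemma bop_comp:
  assumes f: "f \<in> bop L M" and g: "g \<in> bop M N"
  shows "g \<circ> f \<in> bop L N"
proof -
  obtain K where K: "K > 0" "\<And>x. x \<in> L \<Longrightarrow> norm (f x) \<le> K * norm x"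
    by (rule bop_bound[OF f]) blast
  obtain K' where K': "K' > 0" "\<And>x. x \<in> M \<Longrightarrow> norm (g x) \<le> K' * norm x"
    by (rule bop_bound[OF g]) blast
  have "norm (g (f x)) \<le> (K' * K) * norm x" if "x \<in> L" for x
    using K'(2)[OF bop_in[OF f that]] mult_left_mono[OF K(2)[OF that], of K'] K'(1)
    by linarith
  then show ?thesis
    using f g by (intro bopI) (auto simp: bop_in bop_add bop_scaleC)
qed

lemma bop_restrict: "f \<in> bop L M \<Longrightarrow> L' \<subseteq> L \<Longrightarrow> (\<And>x. x \<in> L' \<Longrightarrow> f x \<in> M') \<Longrightarrow> f \<in> bop L' M'"
  unfolding bop_def by blast

lemma bop_plus:
  assumes f: "f \<in> bop L M" and g: "g \<in> bop L M" and M: "complex_vector.subspace M"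
  shows "(\<lambda>x. f x + g x) \<in> bop L M"
proof -
  obtain K where K: "K > 0" "\<And>x. x \<in> L \<Longrightarrow> norm (f x) \<le> K * norm x"
    by (rule bop_bound[OF f]) blast
  obtain K' where K': "K' > 0" "\<And>x. x \<in> L \<Longrightarrow> norm (g x) \<le> K' * norm x"
    by (rule bop_bound[OF g]) blast
  have "norm (f x + g x) \<le> (K + K') * norm x" if "x \<in> L" for x
    using K(2)[OF that] K'(2)[OF that] norm_triangle_ineq[of "f x" "g x"]
    by (simp add: algebra_simps)
  then show ?thesis
    using f g
    by (intro bopI) (auto simp: bop_in bop_add bop_scaleC scaleC_add_right
        complex_vector.subspace_add[OF M])
qed

lemma bop_id: "(\<lambda>x. x) \<in> bop L L"
  by (rule bopI[where K = 1]) auto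

lemma bop_scale:
  assumes f: "f \<in> bop L M" and M: "complex_vector.subspace M"
  shows "(\<lambda>x. c *\<^sub>C f x) \<in> bop L M"
proof -
  obtain K where K: "K > 0" "\<And>x. x \<in> L \<Longrightarrow> norm (f x) \<le> K * norm x"
    by (rule bop_bound[OF f]) blast
  have "norm (c *\<^sub>C f x) \<le> (cmod c * K) * norm x" if "x \<in> L" for x
    using mult_left_mono[OF K(2)[OF that], of "cmod c"] by (simp add: norm_scaleC mult.assoc)
  then show ?thesis
    using f
    by (intro bopI[where K = "cmod c * K"]) (auto simp: bop_in bop_add bop_scaleC scaleC_add_right
        scaleC_scaleC mult.commute[of c] complex_vector.subspace_scale[OF M])
qed

lemma bop_minus:
  assumes "f \<in> bop L M" "g \<in> bop L M" "complex_vector.subspace M"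
  shows "(\<lambda>x. f x - g x) \<in> bop L M"
proof -
  have "(\<lambda>x. f x + (- 1) *\<^sub>C g x) \<in> bop L M"
    by (intro bop_plus bop_scale assms)
  then show ?thesis
    by (simp only: complex_vector.scale_minus_left scaleC_one diff_conv_add_uminus)
qed


section \<open>Orthogonal projections and adjoints\<close>

text \<open>The classical minimal distance argument: the parallelogram law makes near-minimizers
  cluster, completeness supplies a minimizer \<open>p\<close>, and varying \<open>p\<close> along a
  vector \<open>y\<close> of \<open>L\<close> forces orthogonality.\<close>

lemma closed_subspace_orthogonal_decomp:
  fixes L :: "'a::{real_inner, complete_space} set"
  assumes L: "subspace L" and cl: "closed L"
  shows "\<exists>p\<in>L. \<forall>y\<in>L. inner (z - p) y = 0"
proof -
  define D where "D = (\<lambda>x. (norm (z - x))\<^sup>2) ` L"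
  define d where "d = Inf D"
  have bdd: "bdd_below D"
    by (rule bdd_belowI[of _ 0]) (auto simp: D_def)
  have d_le: "d \<le> (norm (z - x))\<^sup>2" if "x \<in> L" for x
    unfolding d_def using that by (intro cInf_lower bdd) (auto simp: D_def)
  have "D \<noteq> {}"
    using subspace_0[OF L] by (auto simp: D_def)
  then have near: "\<exists>x\<in>L. (norm (z - x))\<^sup>2 < d + e" if "e > 0" for e
    using cInf_lessD[of D "d + e"] that by (auto simp: d_def D_def)
  \<comment> \<open>Near-minimizers form a decreasing sequence of nonempty closed sets; once their
    diameters tend to 0, completeness yields a common point.\<close>
  define S where "S n = L \<inter> {x. (norm (z - x))\<^sup>2 \<le> d + 1 / real (Suc n)}" for n
  have mono: "S n \<subseteq> S m" if "m \<le> n" for m n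
  proof -
    have "1 / real (Suc n) \<le> 1 / real (Suc m)"
      using that by (simp add: field_simps)
    then show ?thesis unfolding S_def by auto
  qed
  \<comment> \<open>The midpoint of \<open>x\<close> and \<open>y\<close> lies in \<open>L\<close>,
    so its squared distance from \<open>z\<close> is at least \<open>d\<close>; in the parallelogram
    law the terms in \<open>d\<close> cancel.\<close>
  have par: "(dist x y)\<^sup>2 \<le> 4 / real (Suc n)" if "x \<in> S n" "y \<in> S n" for x y n
  proof -
    have "(1/2) *\<^sub>R (x + y) \<in> L"
      using that L by (auto simp: S_def subspace_add subspace_scale)
    then have "d \<le> (norm (z - (1/2) *\<^sub>R (x + y)))\<^sup>2"
      by (rule d_le)
    moreover have "(dist x y)\<^sup>2 = 2 * (norm (z - x))\<^sup>2 + 2 * (norm (z - y))\<^sup>2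
        - 4 * (norm (z - (1/2) *\<^sub>R (x + y)))\<^sup>2"
      by (simp add: field_simps dist_norm power2_norm_eq_inner inner_diff_left inner_diff_right
          inner_add_left inner_add_right inner_commute)
    moreover have "(norm (z - x))\<^sup>2 \<le> d + 1 / real (Suc n)" "(norm (z - y))\<^sup>2 \<le> d + 1 / real (Suc n)"
      using that by (auto simp: S_def)
    ultimately show ?thesis by linarith
  qed
  obtain p where p: "\<And>n. p \<in> S n"
  proof (rule decreasing_closed_nest[of S])
    show "closed (S n)" for n
      unfolding S_def
      by (intro closed_Int cl closed_Collect_le continuous_intros)
    show "S n \<noteq> {}" for n
      using near[of "1 / real (Suc n)"] by (force simp: S_def)
    show "\<exists>n. \<forall>x\<in>S n. \<forall>y\<in>S n. dist x y < e" if "e > 0" for e :: real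
    proof -
      obtain n where n: "4 / e\<^sup>2 < real n"
        using reals_Archimedean2 by blast
      have "4 / real (Suc n) < e\<^sup>2"
        using n that by (simp add: field_simps) (smt (verit) zero_le_power2)
      then have "dist x y < e" if "x \<in> S n" "y \<in> S n" for x y
        using par[OF that] \<open>e > 0\<close> power2_less_imp_less[of "dist x y" e] by linarith
      then show ?thesis by blast
    qed
  qed (use mono in auto)
  have pL: "p \<in> L"
    using p[of 0] by (simp add: S_def)
  have "(norm (z - p))\<^sup>2 \<le> d"
  proof (rule field_le_epsilon)
    fix e :: real assume "e > 0"
    then obtain n where "1 / real (Suc n) < e"
      using reals_Archimedean by (metis inverse_eq_divide)
    then show "(norm (z - p))\<^sup>2 \<le> d + e"
      using p[of n] by (simp add: S_def)
  qed
  have "inner (z - p) y = 0" if y: "y \<in> L" for y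
  proof (cases "y = 0")
    case False
    \<comment> \<open>This \<open>t\<close> minimizes the squared distance from \<open>z\<close> to
      \<open>p + t *\<^sub>R y\<close>, lowering it by the square of \<open>inner (z - p) y\<close>
      divided by \<open>inner y y\<close>.\<close>
    define t where "t = inner (z - p) y / inner y y"
    have "p + t *\<^sub>R y \<in> L"
      using L pL y by (simp add: subspace_add subspace_scale)
    then have "(norm (z - p))\<^sup>2 \<le> (norm (z - (p + t *\<^sub>R y)))\<^sup>2"
      using d_le \<open>(norm (z - p))\<^sup>2 \<le> d\<close> by (meson order_trans)
    also have "\<dots> = (norm (z - p))\<^sup>2 - 2 * t * inner (z - p) y + t * t * inner y y"
      by (simp add: power2_norm_eq_inner inner_diff_left inner_diff_right
          inner_add_left inner_add_right inner_commute algebra_simps)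
    also have "t * t * inner y y = t * inner (z - p) y"
      using False by (simp add: t_def)
    finally have "t * inner (z - p) y \<le> 0" by simp
    then have "inner (z - p) y * inner (z - p) y \<le> 0"
      using False by (simp add: t_def divide_le_0_iff) (metis inner_gt_zero_iff not_less)
    then show ?thesis
      by (metis linorder_not_le mult_eq_0_iff not_square_less_zero order_antisym)
  qed simp
  then show ?thesis
    using pL by blast
qed

text \<open>For nonzero \<open>f\<close>, the residual \<open>u\<close> of a vector \<open>z\<close>
  outside the kernel is orthogonal to the kernel. Subtracting a suitable multiple of
  \<open>u\<close> from \<open>x\<close> lands in the kernel, so \<open>f\<close> is a multiple of
  the inner product with \<open>u\<close>.\<close>

lemma Riesz_representation:
  fixes f :: "'a::{real_inner, complete_space} \<Rightarrow> real"
  assumes f: "bounded_linear f"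
  shows "\<exists>g. \<forall>x. f x = inner x g"
proof (cases "\<forall>x. f x = 0")
  case True
  then show ?thesis by (intro exI[of _ 0]) simp
next
  case False
  then obtain z where z: "f z \<noteq> 0" by blast
  interpret f: bounded_linear f by fact
  have "subspace {x. f x = 0}"
    by (simp add: subspace_def f.add f.scaleR f.zero)
  moreover have "closed {x. f x = 0}"
    by (intro closed_Collect_eq f.continuous_on continuous_intros)
  ultimately obtain p where p: "f p = 0" "\<And>y. f y = 0 \<Longrightarrow> inner (z - p) y = 0"
    using closed_subspace_orthogonal_decomp[of "{x. f x = 0}" z] by auto
  define u where "u = z - p"
  have fu: "f u \<noteq> 0"
    by (simp add: u_def f.diff p z)
  then have "u \<noteq> 0"
    using f.zero by auto
  have "f x = inner x ((f u / inner u u) *\<^sub>R u)" for x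
  proof -
    have "f (x - (f x / f u) *\<^sub>R u) = 0"
      using fu by (simp add: f.diff f.scaleR)
    then have "inner u (x - (f x / f u) *\<^sub>R u) = 0"
      unfolding u_def by (rule p(2))
    then have "inner u x = f x / f u * inner u u"
      by (simp add: inner_diff_right)
    then show ?thesis
      using fu \<open>u \<noteq> 0\<close> by (simp add: inner_commute)
  qed
  then show ?thesis by blast
qed

lemma complex_subspace_imp_subspace:
  assumes L: "complex_vector.subspace L"
  shows "subspace L"
proof (rule subspaceI)
  show "c *\<^sub>R x \<in> L" if "x \<in> L" for c x
    using complex_vector.subspace_scale[OF L that, of "complex_of_real c"]
    by (simp only: scaleC_of_real)
qed (rule complex_vector.subspace_0[OF L], rule complex_vector.subspace_add[OF L])

text \<open>The real projection exists, and closure of \<open>L\<close> under \<open>\<i>\<close>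
  upgrades its orthogonality to the complex form. Two candidates differ by a vector of
  \<open>L\<close> orthogonal to itself.\<close>

lemma orth_proj_ex1:
  fixes L :: "'a::chilbert_space set"
  assumes L: "complex_vector.subspace L" and cl: "closed L"
  shows "\<exists>!p. p \<in> L \<and> (\<forall>y\<in>L. cinner (x - p) y = 0)"
proof -
  obtain p where p: "p \<in> L" "\<And>y. y \<in> L \<Longrightarrow> inner (x - p) y = 0"
    using closed_subspace_orthogonal_decomp[OF complex_subspace_imp_subspace[OF L] cl] by blast
  have orth: "cinner (x - p) y = 0" if "y \<in> L" for y
    using p(2)[OF that] p(2)[OF complex_vector.subspace_scale[OF L that, of \<i>]]
    by (simp add: cinner_eq_inner complex_eq_iff)
  have uniq: "q = p" if q: "q \<in> L" "\<And>y. y \<in> L \<Longrightarrow> cinner (x - q) y = 0" for q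
  proof -
    have "q - p \<in> L"
      by (rule complex_vector.subspace_diff[OF L q(1) p(1)])
    then have "cinner (x - p) (q - p) - cinner (x - q) (q - p) = 0"
      using orth q(2) by simp
    then show ?thesis
      by (simp flip: cinner_diff_left)
  qed
  show ?thesis
  proof (rule ex1I[of _ p])
    show "p \<in> L \<and> (\<forall>y\<in>L. cinner (x - p) y = 0)"
      using p(1) orth by blast
    show "q = p" if "q \<in> L \<and> (\<forall>y\<in>L. cinner (x - q) y = 0)" for q
      using uniq[of q] that by blast
  qed
qed

text \<open>Real Riesz representation matches the real parts; replacing \<open>x\<close> by
  \<open>\<i> *\<^sub>C x\<close> matches the imaginary parts. Nondegeneracy gives uniqueness, so
  the description in \<open>cadjoint\<close> denotes.\<close>

lemma cadjoint_eq:
  fixes f :: "'a::chilbert_space \<Rightarrow> 'b::chilbert_space"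
  assumes f: "f \<in> bop UNIV UNIV"
  shows "cinner (f x) y = cinner x (cadjoint f y)"
proof -
  interpret f: bounded_linear f
    by (rule bop_bounded_linear[OF f])
  have "\<exists>g. \<forall>x. cinner (f x) y = cinner x g" for y
  proof -
    have "bounded_linear (\<lambda>x. inner (f x) y)"
      by (rule bounded_linear_compose[OF bounded_linear_inner_left f.bounded_linear])
    then obtain g where g: "\<And>x. inner (f x) y = inner x g"
      using Riesz_representation by metis
    have "cinner (f x) y = cinner x g" for x
    proof (rule complex_eqI)
      show "Re (cinner (f x) y) = Re (cinner x g)"
        using g[of x] by (simp add: inner_eq_Re_cinner)
      show "Im (cinner (f x) y) = Im (cinner x g)"
        using g[of "\<i> *\<^sub>C x"] by (simp add: inner_eq_Re_cinner bop_scaleC[OF f] cinner_scaleC_left)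
    qed
    then show ?thesis by blast
  qed
  then obtain g where g: "\<forall>x y. cinner (f x) y = cinner x (g y)"
    by metis
  have "h = g" if h: "\<forall>x y. cinner (f x) y = cinner x (h y)" for h
  proof
    fix y
    have "cinner (h y - g y) (h y - g y) = 0"
      using g[rule_format, of "h y - g y" y] h[rule_format, of "h y - g y" y]
      by (simp add: cinner_diff_right)
    then show "h y = g y" by simp
  qed
  then have "\<exists>!g. \<forall>x y. cinner (f x) y = cinner x (g y)"
    using g by (intro ex1I[of _ g])
  from theI'[OF this] show ?thesis
    unfolding cadjoint_def by blast
qed

text \<open>This is how adjoints leave the argument: the second summands in the matrix
  representations become orthogonal complements of ranges.\<close>

lemma null_space_cadjoint:
  fixes f :: "'a::chilbert_space \<Rightarrow> 'b::chilbert_space"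
  assumes f: "f \<in> bop UNIV UNIV"
  shows "null_space (cadjoint f) = {y. \<forall>x\<in>range f. cinner x y = 0}"
proof -
  have "cadjoint f y = 0 \<longleftrightarrow> (\<forall>x. cinner (f x) y = 0)" for y
    unfolding cadjoint_eq[OF f] by (metis cinner_self_eq_0 cinner_zero_right)
  then show ?thesis
    by (auto simp: null_space_def)
qed


lemma orth_proj:
  fixes L :: "'a::chilbert_space set"
  assumes L: "complex_vector.subspace L" and cl: "closed L"
  shows orth_proj_in: "orth_proj L x \<in> L"
    and orth_proj_orth: "y \<in> L \<Longrightarrow> cinner (x - orth_proj L x) y = 0"
    and orth_proj_eqI: "p \<in> L \<Longrightarrow> (\<And>y. y \<in> L \<Longrightarrow> cinner (x - p) y = 0) \<Longrightarrow> orth_proj L x = p"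
proof -
  have *: "orth_proj L x \<in> L \<and> (\<forall>y\<in>L. cinner (x - orth_proj L x) y = 0)"
    unfolding orth_proj_def by (rule theI'[OF orth_proj_ex1[OF L cl]])
  then show "orth_proj L x \<in> L" "y \<in> L \<Longrightarrow> cinner (x - orth_proj L x) y = 0"
    by blast+
  show "orth_proj L x = p" if "p \<in> L" "\<And>y. y \<in> L \<Longrightarrow> cinner (x - p) y = 0"
    using ex1E[OF orth_proj_ex1[OF L cl, of x]] * that by metis
qed

lemma orth_proj_bop:
  fixes L :: "'a::chilbert_space set"
  assumes L: "complex_vector.subspace L" and cl: "closed L"
  shows "orth_proj L \<in> bop UNIV L"
proof (rule bopI[where K = 1])
  note in_L = orth_proj_in[OF L cl] and orth = orth_proj_orth[OF L cl]
  show "orth_proj L (x + y) = orth_proj L x + orth_proj L y" for x y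
  proof (rule orth_proj_eqI[OF L cl])
    show "orth_proj L x + orth_proj L y \<in> L"
      by (rule complex_vector.subspace_add[OF L in_L in_L])
    show "cinner (x + y - (orth_proj L x + orth_proj L y)) u = 0" if "u \<in> L" for u
      using orth[OF that, of x] orth[OF that, of y]
      by (simp add: cinner_diff_left cinner_add_left)
  qed
  show "orth_proj L (c *\<^sub>C x) = c *\<^sub>C orth_proj L x" for c x
  proof (rule orth_proj_eqI[OF L cl])
    show "c *\<^sub>C orth_proj L x \<in> L"
      by (rule complex_vector.subspace_scale[OF L in_L])
    show "cinner (c *\<^sub>C x - c *\<^sub>C orth_proj L x) u = 0" if "u \<in> L" for u
      using orth[OF that, of x] by (simp add: cinner_scaleC_left flip: scaleC_diff_right)
  qed
  show "norm (orth_proj L x) \<le> 1 * norm x" for x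
  proof -
    \<comment> \<open>The residual is orthogonal to the projection itself, so Cauchy-Schwarz shows
      that the projection is a contraction.\<close>
    have "cinner x (orth_proj L x) = cinner (orth_proj L x) (orth_proj L x)"
      using orth[OF in_L, of x x] by (simp add: cinner_diff_left)
    then have "norm (orth_proj L x) * norm (orth_proj L x) = inner x (orth_proj L x)"
      by (simp add: inner_eq_Re_cinner cinner_self power2_eq_square)
    also have "\<dots> \<le> norm x * norm (orth_proj L x)"
      by (rule norm_cauchy_schwarz)
    finally show ?thesis
      by (cases "orth_proj L x = 0") auto
  qed
qed (rule orth_proj_in[OF L cl])

section \<open>Orthogonal complements and orthogonal sums\<close>

definition orth_compl :: "'a::complex_inner set \<Rightarrow> 'a set" where
  "orth_compl L = {y. \<forall>x\<in>L. cinner x y = 0}"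

lemma orth_complD: "y \<in> orth_compl L \<Longrightarrow> x \<in> L \<Longrightarrow> cinner x y = 0"
  by (simp add: orth_compl_def)

lemma subspace_orth_compl: "complex_vector.subspace (orth_compl L)"
  by (rule complex_vector.subspaceI)
    (auto simp: orth_compl_def cinner_add_right cinner_scaleC_right)

lemma closed_orth_compl: "closed (orth_compl L)"
proof -
  have "cinner x y = 0 \<longleftrightarrow> inner x y = 0 \<and> inner (\<i> *\<^sub>C x) y = 0" for x y :: 'a
    by (simp add: complex_eq_iff inner_eq_Re_cinner cinner_scaleC_left)
  then have "orth_compl L = (\<Inter>x\<in>L. {y. inner x y = 0} \<inter> {y. inner (\<i> *\<^sub>C x) y = 0})"
    by (auto simp: orth_compl_def)
  also have "closed \<dots>"
    by (intro closed_INT ballI closed_Int closed_Collect_eq continuous_intros)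
  finally show ?thesis .
qed

lemma orth_proj_fixed:
  fixes L :: "'a::chilbert_space set"
  assumes "complex_vector.subspace L" "closed L" "x \<in> L"
  shows "orth_proj L x = x"
  by (rule orth_proj_eqI[OF assms]) simp

lemma orth_proj_orth_compl:
  fixes L :: "'a::chilbert_space set"
  assumes "complex_vector.subspace L" "closed L" "x \<in> orth_compl L"
  shows "orth_proj L x = 0"
  using assms by (intro orth_proj_eqI)
    (auto simp: complex_vector.subspace_0 orth_compl_def cinner_eq_zero_commute[of x])

lemma orth_proj_residual:
  fixes L :: "'a::chilbert_space set"
  assumes "complex_vector.subspace L" "closed L"
  shows "x - orth_proj L x \<in> orth_compl L"
  using orth_proj_orth[OF assms] by (simp add: orth_compl_def cinner_eq_zero_commute)

lemma orth_sum_orth_compl: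
  fixes L :: "'a::chilbert_space set"
  assumes L: "complex_vector.subspace L" and cl: "closed L"
  shows "orth_sum L (orth_compl L)"
proof -
  have "\<exists>x\<in>L. \<exists>y\<in>orth_compl L. z = x + y" for z
    by (rule bexI[OF _ orth_proj_in[OF L cl, of z]],
        rule bexI[OF _ orth_proj_residual[OF L cl, of z]]) simp
  then show ?thesis
    using assms subspace_orth_compl closed_orth_compl orth_complD
    unfolding orth_sum_def by blast
qed


section \<open>Quasinilpotent operators\<close>

text \<open>For nonzero \<open>z\<close>, \<open>1 - z N\<close> is \<open>z\<close> times
  \<open>1 / z - N\<close>, and \<open>1 / z\<close> lies outside the spectrum; at
  \<open>z = 0\<close> the operator is the identity. So the inverse exists on the whole plane, as an
  entire function requires.\<close>

lemma quasinilpotent_resolvent: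
  fixes N :: "'a::chilbert_space \<Rightarrow> 'a"
  assumes N: "quasinilpotent UNIV N"
  shows "\<exists>R \<in> bop UNIV UNIV. (\<forall>x. R (x - z *\<^sub>C N x) = x) \<and> (\<forall>x. R x - z *\<^sub>C N (R x) = x)"
proof (cases "z = 0")
  case True
  then show ?thesis
    by (intro bexI[OF _ bop_id]) (simp add: scaleC_zero_left)
next
  case False
  have "1 / z \<notin> spectrum UNIV N"
    using N False by (auto simp: quasinilpotent_def)
  then obtain g where g: "g \<in> bop UNIV UNIV" 
      "\<And>x. g ((1 / z) *\<^sub>C x - N x) = x" "\<And>x. (1 / z) *\<^sub>C g x - N (g x) = x"
    unfolding spectrum_def invertible_op_def by auto
  define R where "R x = (1 / z) *\<^sub>C g x" for x
  have R: "R \<in> bop UNIV UNIV"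
    unfolding R_def using g(1) by (rule bop_scale) simp
  have "R (x - z *\<^sub>C N x) = x" for x
  proof -
    have "R (x - z *\<^sub>C N x) = g ((1 / z) *\<^sub>C (x - z *\<^sub>C N x))"
      by (simp add: R_def bop_scaleC[OF g(1)])
    also have "(1 / z) *\<^sub>C (x - z *\<^sub>C N x) = (1 / z) *\<^sub>C x - N x"
      using False by (simp add: scaleC_diff_right scaleC_scaleC scaleC_one)
    finally show ?thesis by (simp add: g)
  qed
  moreover have "R x - z *\<^sub>C N (R x) = x" for x
  proof -
    have "N \<in> bop UNIV UNIV"
      using N by (simp add: quasinilpotent_def)
    then have "z *\<^sub>C N (R x) = N (g x)"
      using False by (simp add: R_def bop_scaleC scaleC_scaleC scaleC_one)
    then show ?thesis by (simp add: R_def g)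
  qed
  ultimately show ?thesis
    using R by blast
qed

text \<open>
  Continuity and differentiability of \<open>R\<close> both come from the resolvent identity
  \<open>R z - R w = (z - w) R w N R z\<close>, without a Neumann series.
\<close>

lemma resolvent_holomorphic:
  fixes N :: "'a::chilbert_space \<Rightarrow> 'a" and G :: "'a \<Rightarrow> 'b::chilbert_space"
  assumes N: "N \<in> bop UNIV UNIV" and G: "G \<in> bop UNIV UNIV"
    and R: "\<And>z. R z \<in> bop UNIV UNIV"
    and left: "\<And>z x. R z (x - z *\<^sub>C N x) = x" and right: "\<And>z x. R z x - z *\<^sub>C N (R z x) = x"
  shows "(\<lambda>z. cinner (G (R z x)) y) holomorphic_on UNIV"
proof -
  have identity: "R z v - R w v = (z - w) *\<^sub>C R w (N (R z v))" for z w v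
  proof -
    have "R z v - w *\<^sub>C N (R z v) = v + (z - w) *\<^sub>C N (R z v)"
      using right[of z v] by (simp add: scaleC_diff_left algebra_simps)
    then have "R z v = R w (v + (z - w) *\<^sub>C N (R z v))"
      using left[of w "R z v"] by simp
    also have "\<dots> = R w v + (z - w) *\<^sub>C R w (N (R z v))"
      by (simp add: bop_add[OF R] bop_scaleC[OF R])
    finally show ?thesis
      by (metis add_diff_cancel_left')
  qed
  have cont: "((\<lambda>z. R z v) \<longlongrightarrow> R w v) (at w)" for w v
  proof -
    obtain K where K: "K > 0" "\<And>u. norm (R w (N u)) \<le> K * norm u"
      using bop_bound[OF bop_comp[OF N R[of w]]] by (metis UNIV_I comp_apply)
    have diff: "norm (R z v - R w v) \<le> cmod (z - w) * (K * norm (R z v))" for z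
      unfolding identity[of z v w] norm_scaleC by (intro mult_left_mono K) auto
    \<comment> \<open>Near \<open>w\<close> the difference is at most half of
      \<open>norm (R z v)\<close>, so \<open>norm (R z v)\<close> is at most twice
      \<open>norm (R w v)\<close>. This gives a bound whose only dependence on \<open>z\<close> is
      the factor \<open>cmod (z - w)\<close>.\<close>
    have bound: "norm (R z v - R w v) \<le> cmod (z - w) * (K * (2 * norm (R w v)))"
      if "cmod (z - w) < 1 / (2 * K)" for z
    proof -
      have "cmod (z - w) * (K * norm (R z v)) \<le> (1 / (2 * K)) * (K * norm (R z v))"
        using that K(1) by (intro mult_right_mono) auto
      also have "\<dots> = norm (R z v) / 2"
        using K(1) by simp
      finally have "norm (R z v) \<le> 2 * norm (R w v)"
        using diff[of z] norm_triangle_ineq2[of "R z v" "R w v"] by simp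
      then have "cmod (z - w) * (K * norm (R z v)) \<le> cmod (z - w) * (K * (2 * norm (R w v)))"
        using K(1) by (intro mult_left_mono) auto
      then show ?thesis
        using diff[of z] by linarith
    qed
    have "((\<lambda>z. R z v - R w v) \<longlongrightarrow> 0) (at w)"
    proof (rule Lim_null_comparison)
      show "\<forall>\<^sub>F z in at w. norm (R z v - R w v) \<le> cmod (z - w) * (K * (2 * norm (R w v)))"
        unfolding eventually_at
        using bound K(1) by (intro exI[of _ "1 / (2 * K)"]) (auto simp: dist_norm)
      show "((\<lambda>z. cmod (z - w) * (K * (2 * norm (R w v)))) \<longlongrightarrow> 0) (at w)"
        by (auto intro!: tendsto_eq_intros)
    qed
    then show ?thesis
      by (simp add: LIM_zero_iff)
  qed
  \<comment> \<open>By the resolvent identity the difference quotient is the pairing of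
    \<open>G (R w (N (R z x)))\<close> with \<open>y\<close>, so continuity of \<open>R\<close>
    alone gives the derivative.\<close>
  have "((\<lambda>z. cinner (G (R z x)) y) has_field_derivative cinner (G (R w (N (R w x)))) y) (at w)" for w
    unfolding has_field_derivative_iff
  proof (rule Lim_transform_eventually)
    have "bounded_linear (\<lambda>v. cinner (G (R w (N v))) y)"
    proof -
      have GRN: "G \<circ> (R w \<circ> N) \<in> bop UNIV UNIV"
        by (rule bop_comp[OF bop_comp[OF N R] G])
      obtain K where K: "K > 0" "\<And>v. norm (G (R w (N v))) \<le> K * norm v"
        using bop_bound[OF GRN] by (metis UNIV_I comp_apply)
      have "cmod (cinner (G (R w (N v))) y) \<le> norm v * (2 * K * norm y)" for v
        using order_trans[OF norm_cinner_le, of "G (R w (N v))" y "norm v * (2 * K * norm y)"]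
          mult_right_mono[OF K(2)[of v] norm_ge_zero[of y]]
        by (simp add: algebra_simps)
      then show ?thesis
        by (intro bounded_linear_intro)
          (auto simp: bop_add[OF N] bop_add[OF R] bop_add[OF G] cinner_add_left
            bop_scaleC[OF N] bop_scaleC[OF R] bop_scaleC[OF G] cinner_scaleC_left
            scaleR_conv_of_real simp flip: scaleC_of_real)
    qed
    then show "((\<lambda>z. cinner (G (R w (N (R z x)))) y) \<longlongrightarrow> cinner (G (R w (N (R w x)))) y) (at w)"
      using cont by (rule bounded_linear.tendsto)
    show "\<forall>\<^sub>F z in at w. cinner (G (R w (N (R z x)))) y
        = (cinner (G (R z x)) y - cinner (G (R w x)) y) / (z - w)"
      unfolding eventually_at_filter
      by (rule always_eventually)
        (simp add: cinner_diff_left[symmetric] bop_diff[OF G, symmetric] identity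
          bop_scaleC[OF G] cinner_scaleC_left)
  qed
  then show ?thesis
    unfolding holomorphic_on_def field_differentiable_def by blast
qed

lemma bounded_decay_tendsto_0:
  fixes f :: "complex \<Rightarrow> complex"
  assumes "\<And>z. cmod z > K \<Longrightarrow> (cmod z - K) * cmod (f z) \<le> C"
  shows "(f \<longlongrightarrow> 0) at_infinity"
proof (rule Lim_null_comparison)
  show "\<forall>\<^sub>F z in at_infinity. cmod (f z) \<le> C / (cmod z - K)"
    unfolding eventually_at_infinity
    using assms by (intro exI[of _ "K + 1"]) (auto simp: field_simps)
  have "filterlim (\<lambda>z::complex. cmod z - K) at_top at_infinity"
    using filterlim_tendsto_add_at_top[OF tendsto_const[of "- K"] filterlim_norm_at_top]
    by simp
  then show "((\<lambda>z::complex. C / (cmod z - K)) \<longlongrightarrow> 0) at_infinity"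
    by (rule real_tendsto_divide_at_top[OF tendsto_const])
qed

text \<open>
  This lemma and its mirror image replace the spectral radius formula: \<open>E (1 - z N)\<^sup>-\<^sup>1\<close> is entire
  in \<open>z\<close> and equals \<open>(S - z)\<^sup>-\<^sup>1 S E\<close> for large \<open>z\<close>, so it vanishes by Liouville's theorem.
\<close>

lemma quasinilpotent_intertwine_left:
  fixes N E :: "'a::chilbert_space \<Rightarrow> 'a"
  assumes N: "quasinilpotent UNIV N" and S: "S \<in> bop UNIV UNIV" and E: "E \<in> bop UNIV UNIV"
    and eq: "\<And>x. E x = S (E (N x))"
  shows "E x = 0"
proof -
  have N': "N \<in> bop UNIV UNIV"
    using N by (simp add: quasinilpotent_def)
  obtain R where R: "\<And>z. R z \<in> bop UNIV UNIV" "\<And>z x. R z (x - z *\<^sub>C N x) = x"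
      "\<And>z x. R z x - z *\<^sub>C N (R z x) = x"
    using quasinilpotent_resolvent[OF N] by metis
  obtain K where K: "K > 0" "\<And>u. norm (S u) \<le> K * norm u"
    using bop_bound[OF S] by (metis UNIV_I)
  \<comment> \<open>Apply \<open>S E\<close> to \<open>R z x = x + z N (R z x)\<close> and use
    \<open>E = S E N\<close>; this is \<open>(S - z) E (R z x) = S E x\<close>.\<close>
  have *: "z *\<^sub>C E (R z x) = S (E (R z x)) - S (E x)" for z
  proof -
    have "E (R z x) = E (x + z *\<^sub>C N (R z x))"
      using R(3)[of z x] by (simp add: algebra_simps)
    then have "S (E (R z x)) = S (E x) + z *\<^sub>C S (E (N (R z x)))"
      by (simp add: bop_add[OF E] bop_add[OF S] bop_scaleC[OF E] bop_scaleC[OF S])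
    then show ?thesis
      by (simp flip: eq)
  qed
  have decay: "(cmod z - K) * norm (E (R z x)) \<le> norm (S (E x))" for z
    using norm_triangle_ineq4[of "S (E (R z x))" "S (E x)"] K(2)[of "E (R z x)"]
    by (simp add: *[symmetric] norm_scaleC algebra_simps)
  \<comment> \<open>Pairing with an arbitrary \<open>y\<close> reduces the claim to Liouville's
    theorem for scalar functions. Evaluation at 0, where \<open>R\<close> is the identity, then
    recovers \<open>E x\<close>.\<close>
  have "cinner (E (R z x)) y = 0" for z y
  proof (rule Liouville_weak_0[where f = "\<lambda>z. cinner (E (R z x)) y" and z = z])
    show "(\<lambda>z. cinner (E (R z x)) y) holomorphic_on UNIV"
      using N' E R by (rule resolvent_holomorphic)
    show "((\<lambda>z. cinner (E (R z x)) y) \<longlongrightarrow> 0) at_infinity"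
    proof (rule bounded_decay_tendsto_0)
      fix z assume "cmod z > K"
      then have "(cmod z - K) * cmod (cinner (E (R z x)) y)
          \<le> (cmod z - K) * (2 * (norm (E (R z x)) * norm y))"
        by (intro mult_left_mono norm_cinner_le) auto
      also have "\<dots> \<le> 2 * (norm (S (E x)) * norm y)"
        using mult_right_mono[OF decay[of z] norm_ge_zero[of y]] by (simp add: algebra_simps)
      finally show "(cmod z - K) * cmod (cinner (E (R z x)) y) \<le> 2 * (norm (S (E x)) * norm y)" .
    qed
  qed
  then have "E (R 0 x) = 0"
    by (metis cinner_self_eq_0)
  then show ?thesis
    using R(3)[of 0 x] by (simp add: scaleC_zero_left)
qed

lemma quasinilpotent_intertwine_right:
  fixes N E :: "'a::chilbert_space \<Rightarrow> 'a"
  assumes N: "quasinilpotent UNIV N" and S: "S \<in> bop UNIV UNIV" and E: "E \<in> bop UNIV UNIV"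
    and eq: "\<And>x. E x = N (E (S x))"
  shows "E x = 0"
proof -
  have N': "N \<in> bop UNIV UNIV"
    using N by (simp add: quasinilpotent_def)
  obtain R where R: "\<And>z. R z \<in> bop UNIV UNIV" "\<And>z x. R z (x - z *\<^sub>C N x) = x"
      "\<And>z x. R z x - z *\<^sub>C N (R z x) = x"
    using quasinilpotent_resolvent[OF N] by metis
  obtain K where K: "K > 0" "\<And>u. norm (S u) \<le> K * norm u"
    using bop_bound[OF S] by (metis UNIV_I)
  obtain C where C: "C > 0" "\<And>u. norm (E (S u)) \<le> C * norm u"
    using bop_bound[OF bop_comp[OF S E]] by (metis UNIV_I comp_apply)
  have *: "z *\<^sub>C R z (E u) = R z (E (S u)) - E (S u)" for z u
  proof -
    have "z *\<^sub>C R z (E u) = z *\<^sub>C R z (N (E (S u)))"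
      by (simp flip: eq)
    also have "\<dots> = R z (E (S u)) - R z (E (S u) - z *\<^sub>C N (E (S u)))"
      by (simp add: bop_diff[OF R(1)] bop_scaleC[OF R(1)])
    finally show ?thesis
      by (simp add: R(2))
  qed
  \<comment> \<open>Here \<open>S\<close> acts first, so the identity relates values at
    \<open>u\<close> and at \<open>S u\<close>, and the decay estimate does not close at a single
    vector. It does close for the operator norm.\<close>
  define n where "n z = onorm (R z \<circ> E)" for z
  have bl: "bounded_linear (R z \<circ> E)" for z
    by (rule bop_bounded_linear[OF bop_comp[OF E R(1)]])
  have n: "norm (R z (E u)) \<le> n z * norm u" "0 \<le> n z" for z u
    using onorm[OF bl, of z u] onorm_pos_le[OF bl] by (simp_all add: n_def)
  have decay: "(cmod z - K) * n z \<le> C" if z: "cmod z > K" for z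
  proof -
    have "cmod z > 0"
      using z K(1) by linarith
    have "norm ((R z \<circ> E) u) \<le> ((n z * K + C) / cmod z) * norm u" for u
    proof -
      have "cmod z * norm (R z (E u)) \<le> norm (R z (E (S u))) + norm (E (S u))"
        using norm_triangle_ineq4[of "R z (E (S u))" "E (S u)"]
        by (simp add: *[symmetric] norm_scaleC)
      also have "\<dots> \<le> n z * (K * norm u) + C * norm u"
        using n(1)[of z "S u"] mult_left_mono[OF K(2)[of u] n(2)[of z]] C(2)[of u] by linarith
      finally show ?thesis
        using \<open>cmod z > 0\<close> by (simp add: pos_le_divide_eq algebra_simps)
    qed
    then have "n z \<le> (n z * K + C) / cmod z"
      unfolding n_def using n(2)[of z] z K(1) C(1)
      by (intro onorm_bound) (auto simp: n_def[symmetric] intro!: divide_nonneg_nonneg add_nonneg_nonneg)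
    then show ?thesis
      using \<open>cmod z > 0\<close> by (simp add: pos_le_divide_eq algebra_simps)
  qed
  have id: "(\<lambda>x. x) \<in> bop UNIV (UNIV :: 'a set)"
    by (rule bop_id)
  have "cinner (R z (E x)) y = 0" for z y
  proof (rule Liouville_weak_0[where f = "\<lambda>z. cinner (R z (E x)) y" and z = z])
    show "(\<lambda>z. cinner (R z (E x)) y) holomorphic_on UNIV"
      using N' id R by (rule resolvent_holomorphic)
    show "((\<lambda>z. cinner (R z (E x)) y) \<longlongrightarrow> 0) at_infinity"
    proof (rule bounded_decay_tendsto_0)
      fix z assume z: "cmod z > K"
      then have "(cmod z - K) * cmod (cinner (R z (E x)) y)
          \<le> (cmod z - K) * (2 * ((n z * norm x) * norm y))"
        by (intro mult_left_mono order_trans[OF norm_cinner_le] mult_right_mono n) auto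
      also have "\<dots> \<le> C * (2 * (norm x * norm y))"
        using mult_right_mono[OF decay[OF z], of "2 * (norm x * norm y)"] by (simp add: algebra_simps)
      finally show "(cmod z - K) * cmod (cinner (R z (E x)) y) \<le> C * (2 * (norm x * norm y))" .
    qed
  qed
  then have "R 0 (E x) = 0"
    by (metis cinner_self_eq_0)
  then show ?thesis
    using R(3)[of 0 "E x"] by (simp add: scaleC_zero_left)
qed


lemma bop_cong:
  assumes "\<And>x. x \<in> L \<Longrightarrow> f x = g x" "complex_vector.subspace L"
  shows "f \<in> bop L M \<longleftrightarrow> g \<in> bop L M"
  using assms complex_vector.subspace_add[OF assms(2)] complex_vector.subspace_scale[OF assms(2)]
  unfolding bop_def by simp

text \<open>
  \<open>c - g f\<close> has the inverse \<open>(1 + g r f) / c\<close>, where \<open>r\<close> is the inverse of \<open>c - f g\<close>.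
\<close>

lemma quasinilpotent_comp_commute:
  fixes f :: "'a::chilbert_space \<Rightarrow> 'b::chilbert_space" and g :: "'b \<Rightarrow> 'a"
  assumes f: "f \<in> bop UNIV UNIV" and g: "g \<in> bop UNIV UNIV"
    and q: "quasinilpotent UNIV (f \<circ> g)"
  shows "quasinilpotent UNIV (g \<circ> f)"
proof -
  have U: "complex_vector.subspace (UNIV :: 'a set)"
    by (rule complex_vector.subspace_UNIV)
  have "invertible_op UNIV UNIV (\<lambda>x. c *\<^sub>C x - (g \<circ> f) x)" if c: "c \<noteq> 0" for c
  proof -
    have "c \<notin> spectrum UNIV (f \<circ> g)"
      using q c by (auto simp: quasinilpotent_def)
    then obtain r where r: "r \<in> bop UNIV UNIV"
        "\<And>y. r (c *\<^sub>C y - f (g y)) = y" "\<And>y. c *\<^sub>C r y - f (g (r y)) = y"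
      unfolding spectrum_def invertible_op_def by auto
    define h where "h x = (1 / c) *\<^sub>C (x + (g \<circ> (r \<circ> f)) x)" for x
    have h: "h \<in> bop UNIV UNIV"
      unfolding h_def by (intro bop_scale bop_plus bop_id bop_comp[OF _ g] bop_comp[OF f] r U)
    have "h (c *\<^sub>C x - g (f x)) = x" for x
    proof -
      have "f (c *\<^sub>C x - g (f x)) = c *\<^sub>C f x - f (g (f x))"
        by (simp add: bop_diff[OF f] bop_scaleC[OF f])
      then show ?thesis
        using c by (simp add: h_def r scaleC_scaleC scaleC_one)
    qed
    moreover have "c *\<^sub>C h x - g (f (h x)) = x" for x
    proof -
      have "c *\<^sub>C r (f x) = f x + f (g (r (f x)))"
        using r(3)[of "f x"] by (simp add: algebra_simps)
      then have "f (h x) = r (f x)"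
        using c by (simp add: h_def bop_scaleC[OF f] bop_add[OF f] scaleC_scaleC scaleC_one
            flip: \<open>c *\<^sub>C r (f x) = _\<close>)
      then show ?thesis
        using c by (simp add: h_def scaleC_scaleC scaleC_one)
    qed
    moreover have "(\<lambda>x. c *\<^sub>C x - (g \<circ> f) x) \<in> bop UNIV UNIV"
      by (intro bop_minus bop_scale bop_id bop_comp[OF f g] U)
    ultimately show ?thesis
      unfolding invertible_op_def using h by (auto intro!: bexI[of _ h])
  qed
  then show ?thesis
    unfolding quasinilpotent_def spectrum_def using bop_comp[OF f g] by auto
qed


section \<open>Generalized Drazin inverses\<close>

locale gdrazin_pair =
  fixes T S :: "'a::chilbert_space \<Rightarrow> 'a"
  assumes T: "T \<in> bop UNIV UNIV" and inverse: "is_gdrazin_inverse T S"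
begin

lemma S: "S \<in> bop UNIV UNIV"
  using inverse by (simp add: is_gdrazin_inverse_def)

lemma commute: "T (S x) = S (T x)"
  using inverse by (auto simp: is_gdrazin_inverse_def fun_eq_iff)

lemma S_S_T: "S (S (T x)) = S x"
proof -
  have "S (T (S x)) = S x"
    using inverse by (auto simp: is_gdrazin_inverse_def fun_eq_iff)
  then show ?thesis
    by (simp add: commute)
qed

lemma quasinilpotent_part: "quasinilpotent UNIV (\<lambda>x. T x - S (T (T x)))"
  using inverse by (simp add: is_gdrazin_inverse_def commute)

text \<open>With the idempotent \<open>Q = 1 - S T\<close>, the operator \<open>N = T Q\<close> is
  quasinilpotent. Then \<open>E = S' T Q\<close> satisfies \<open>E = S' E N\<close>, and
  \<open>E = Q S' T\<close> satisfies \<open>E = N E S'\<close>, so both vanish by the intertwining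
  lemmas.\<close>

lemma spectral_projections_absorb:
  assumes "gdrazin_pair T S'"
  shows "S' (T (S (T x))) = S' (T x)" "S (T (S' (T x))) = S' (T x)"
proof -
  interpret S': gdrazin_pair T S' by fact
  note U = complex_vector.subspace_UNIV
  define Q where "Q x = x - (S \<circ> T) x" for x
  have Q: "Q \<in> bop UNIV UNIV"
    unfolding Q_def by (intro bop_minus bop_id bop_comp[OF T S] U)
  have QT: "Q (T x) = T (Q x)" and QQ: "Q (Q x) = Q x" for x
    by (simp_all add: Q_def bop_diff[OF T] bop_diff[OF S] commute S_S_T)
  have N: "quasinilpotent UNIV (\<lambda>x. T (Q x))"
    using quasinilpotent_part by (simp add: Q_def bop_diff[OF T] commute)
  have "S' (T (Q x)) = 0"
  proof (rule quasinilpotent_intertwine_left[OF N S'.S, of "S' \<circ> (T \<circ> Q)", unfolded comp_def])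
    show "(\<lambda>x. S' (T (Q x))) \<in> bop UNIV UNIV"
      using bop_comp[OF bop_comp[OF Q T] S'.S] by (simp add: comp_def)
    show "S' (T (Q x)) = S' (S' (T (Q (T (Q x)))))" for x
      by (simp add: QT QQ S'.S_S_T)
  qed
  then show "S' (T (S (T x))) = S' (T x)"
    by (simp add: Q_def bop_diff[OF T] bop_diff[OF S'.S])
  have "Q (S' (T x)) = 0"
  proof (rule quasinilpotent_intertwine_right[OF N S'.S, of "Q \<circ> (S' \<circ> T)", unfolded comp_def])
    show "(\<lambda>x. Q (S' (T x))) \<in> bop UNIV UNIV"
      using bop_comp[OF bop_comp[OF T S'.S] Q] by (simp add: comp_def)
    show "Q (S' (T x)) = T (Q (Q (S' (T (S' x)))))" for x
      by (simp add: QQ S'.commute S'.S_S_T flip: QT)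
  qed
  then show "S (T (S' (T x))) = S' (T x)"
    by (simp add: Q_def)
qed

text \<open>Absorption in both directions makes the idempotents \<open>S T\<close> and
  \<open>S' T\<close> equal. The inverses then agree since each is reproduced by its
  idempotent.\<close>

lemma unique:
  assumes "is_gdrazin_inverse T S'"
  shows "S' = S"
proof
  have "gdrazin_pair T S'"
    using T assms by unfold_locales
  then interpret S': gdrazin_pair T S' .
  have eq: "S' (T x) = S (T x)" for x
    using spectral_projections_absorb(2)[OF S'.gdrazin_pair_axioms, of x]
      S'.spectral_projections_absorb(1)[OF gdrazin_pair_axioms, of x] by simp
  show "S' x = S x" for x
    by (metis eq S'.S_S_T S_S_T S'.commute commute)
qed

lemma gdrazin_eq: "gdrazin T = S"
  unfolding gdrazin_def using inverse unique by (rule the_equality)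

text \<open>The range is the fixed set of the bounded idempotent \<open>S T\<close>. Hence it is a
  closed subspace, on which \<open>S\<close> and \<open>T\<close> are mutually inverse.\<close>

lemma range_eq: "x \<in> range S \<longleftrightarrow> S (T x) = x"
proof
  assume "x \<in> range S"
  then obtain y where "x = S y" by blast
  then show "S (T x) = x"
    by (simp add: commute S_S_T)
qed (metis rangeI)

lemma S_T_range: "x \<in> range S \<Longrightarrow> S (T x) = x"
  by (simp add: range_eq)

lemma T_range: "x \<in> range S \<Longrightarrow> T x \<in> range S"
  by (auto simp: commute)

lemma range_eq_fixed: "range S = {x. S (T x) = x}"
  using range_eq by blast

lemma subspace_range: "complex_vector.subspace (range S)"
  unfolding range_eq_fixed
  by (rule complex_vector.subspaceI)
    (simp_all add: bop_zero[OF S] bop_zero[OF T] bop_add[OF T] bop_add[OF S]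
      bop_scaleC[OF T] bop_scaleC[OF S])

lemma closed_range: "closed (range S)"
proof -
  interpret ST: bounded_linear "S \<circ> T"
    by (rule bop_bounded_linear[OF bop_comp[OF T S]])
  have "closed {x. (S \<circ> T) x = x}"
    by (intro closed_Collect_eq ST.continuous_on continuous_intros)
  then show ?thesis
    by (simp add: range_eq_fixed)
qed

section \<open>Core-EP and weak group inverses via the orthogonal projection onto the range\<close>

lemmas proj_in = orth_proj_in[OF subspace_range closed_range]
  and proj_fixed = orth_proj_fixed[OF subspace_range closed_range]
  and proj_orth_compl = orth_proj_orth_compl[OF subspace_range closed_range]
  and proj_residual = orth_proj_residual[OF subspace_range closed_range]

lemma proj_bop: "orth_proj (range S) \<in> bop UNIV UNIV"
  by (rule bop_restrict[OF orth_proj_bop[OF subspace_range closed_range]]) auto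

text \<open>A candidate \<open>B\<close> takes values in the range of \<open>S\<close>, where
  \<open>S T\<close> is the identity, so \<open>B = S T B\<close>, and \<open>T B\<close> is
  prescribed.\<close>

lemma core_EP_eq: "core_EP T = S \<circ> orth_proj (range S)"
  unfolding core_EP_def gdrazin_eq
proof (rule the_equality)
  show "S \<circ> orth_proj (range S) \<in> bop UNIV UNIV \<and>
      T \<circ> (S \<circ> orth_proj (range S)) = orth_proj (range S) \<and>
      range (S \<circ> orth_proj (range S)) \<subseteq> range S"
    using bop_comp[OF proj_bop S] by (auto simp: fun_eq_iff commute S_T_range[OF proj_in])
  fix B assume B: "B \<in> bop UNIV UNIV \<and> T \<circ> B = orth_proj (range S) \<and> range B \<subseteq> range S"
  show "B = S \<circ> orth_proj (range S)"
  proof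
    fix x
    have "B x \<in> range S"
      using B by auto
    then have "S ((T \<circ> B) x) = B x"
      by (simp add: S_T_range)
    then show "B x = (S \<circ> orth_proj (range S)) x"
      using B by simp
  qed
qed

lemma weak_group_eq: "weak_group T x = S (S (orth_proj (range S) (T x)))"
  by (simp add: weak_group_def core_EP_eq proj_fixed)

lemma weak_group_eqs_iff:
  assumes U: "U \<in> bop UNIV UNIV"
  shows "T \<circ> weak_group T = U \<circ> weak_group T \<and> weak_group T \<circ> T = weak_group T \<circ> U \<longleftrightarrow>
    (\<forall>x\<in>range S. U x = T x) \<and>
    (\<forall>y\<in>orth_compl (range S). orth_proj (range S) (T (T y - U y)) = 0)"
    (is "?L1 \<and> ?L2 \<longleftrightarrow> ?R1 \<and> ?R2")
proof -
  let ?p = "orth_proj (range S)"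
  have "?L1 \<longleftrightarrow> ?R1"
  proof
    assume L1: ?L1
    show ?R1
    proof
      fix x assume x: "x \<in> range S"
      \<comment> \<open>Every \<open>x\<close> in the range of \<open>S\<close> is thus a value of
        the weak group inverse, so the equation of compositions can be read off at
        \<open>x\<close>.\<close>
      then have "weak_group T (T x) = x"
        by (simp add: weak_group_eq proj_fixed T_range S_T_range)
      then show "U x = T x"
        using fun_cong[OF L1, of "T x"] by simp
    qed
  qed (auto simp: weak_group_eq fun_eq_iff)
  moreover have "?L2 \<longleftrightarrow> ?R2" if R1: ?R1
  proof -
    have "weak_group T (T x) = weak_group T (U x) \<longleftrightarrow> ?p (T (T x - U x)) = 0" for x
    proof -
      have "weak_group T (T x) = weak_group T (U x) \<longleftrightarrow> S (S (?p (T (T x - U x)))) = 0"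
        by (simp add: weak_group_eq bop_diff[OF S] bop_diff[OF T] bop_diff[OF proj_bop])
      \<comment> \<open>The factor \<open>S\<close> is injective on its own range, where the
        projection takes its values, and can be cancelled twice.\<close>
      also have "\<dots> \<longleftrightarrow> ?p (T (T x - U x)) = 0"
        by (metis S_T_range commute proj_in bop_zero[OF S] bop_zero[OF T] UNIV_I)
      finally show ?thesis .
    qed
    then have "?L2 \<longleftrightarrow> (\<forall>x. ?p (T (T x - U x)) = 0)"
      by (simp add: fun_eq_iff)
    also have "\<dots> \<longleftrightarrow> ?R2"
    proof
      assume R2: ?R2
      show "\<forall>x. ?p (T (T x - U x)) = 0"
      proof
        fix x
        have "U (?p x) = T (?p x)"
          using R1 proj_in by blast
        \<comment> \<open>The difference \<open>T - U\<close> vanishes on the range, so only the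
          component of \<open>x\<close> in the complement contributes.\<close>
        then have "T x - U x = T (x - ?p x) - U (x - ?p x)"
          by (simp add: bop_diff[OF T] bop_diff[OF U])
        then show "?p (T (T x - U x)) = 0"
          using R2 proj_residual[of x] by simp
      qed
    qed simp
    finally show ?thesis .
  qed
  ultimately show ?thesis by blast
qed

text \<open>
  Relative to \<open>range S\<close> and its complement, \<open>c - T (1 - S T)\<close> is block upper triangular with
  invertible corner \<open>c\<close>, so its inverse compresses to an inverse of the lower right entry.
\<close>

lemma quasinilpotent_compression:
  "quasinilpotent (orth_compl (range S)) (\<lambda>x. T x - orth_proj (range S) (T x))"
proof -
  let ?M = "range S" and ?N = "orth_compl (range S)"
  define q where "q x = x - orth_proj ?M x" for x
  have q_bop: "q \<in> bop UNIV UNIV"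
    unfolding q_def by (intro bop_minus bop_id proj_bop complex_vector.subspace_UNIV)
  have q_in: "q x \<in> ?N" for x
    by (simp add: q_def proj_residual)
  have q_range: "q x = 0" if "x \<in> ?M" for x
    using that by (simp add: q_def proj_fixed)
  have q_fixed: "q x = x" if "x \<in> ?N" for x
    using that by (simp add: q_def proj_orth_compl)
  \<comment> \<open>\<open>K\<close> vanishes on the range of \<open>S\<close> and differs from
    \<open>T\<close> by values in that range, so \<open>K\<close> and \<open>T\<close> have the same
    compression to the complement.\<close>
  define K where "K x = T x - S (T (T x))" for x
  have K_quasi: "quasinilpotent UNIV K"
    unfolding K_def by (rule quasinilpotent_part)
  then have K_bop: "K \<in> bop UNIV UNIV"
    by (simp add: quasinilpotent_def)
  have K_range: "K x = 0" if "x \<in> ?M" for x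
    using that by (simp add: K_def S_T_range T_range)
  have qK: "q (K x) = q (T x)" for x
    using q_range[of "S (T (T x))"] by (simp add: K_def bop_diff[OF q_bop])
  have in_bop: "q \<circ> f \<in> bop ?N ?N" if "f \<in> bop UNIV UNIV" for f
    by (rule bop_restrict[OF bop_comp[OF that q_bop]]) (auto simp: q_in)
  have inv: "invertible_op ?N ?N (\<lambda>x. c *\<^sub>C x - (q \<circ> T) x)" if c: "c \<noteq> 0" for c
  proof -
    have "c \<notin> spectrum UNIV K"
      using K_quasi c by (auto simp: quasinilpotent_def)
    then obtain R where R: "R \<in> bop UNIV UNIV"
        "\<And>x. R (c *\<^sub>C x - K x) = x" "\<And>x. c *\<^sub>C R x - K (R x) = x"
      unfolding spectrum_def invertible_op_def by auto
    \<comment> \<open>On the range \<open>c - K\<close> is multiplication by \<open>c\<close>, so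
      \<open>R\<close> maps the range into itself: the inverse is block triangular too.\<close>
    have qR: "q (R x) = 0" if x: "x \<in> ?M" for x
    proof -
      have "c *\<^sub>C R x = R (c *\<^sub>C x - K x)"
        by (simp add: K_range[OF x] bop_scaleC[OF R(1)])
      then have "c *\<^sub>C q (R x) = q x"
        by (simp add: R(2) flip: bop_scaleC[OF q_bop])
      then show ?thesis
        using c by (simp add: q_range[OF x] complex_vector.scale_eq_0_iff)
    qed
    have qRq: "q (R (q x)) = q (R x)" for x
      using qR[OF proj_in[of x]] by (simp add: q_def[of x] bop_diff[OF R(1)] bop_diff[OF q_bop])
    have Kq: "K (q x) = K x" for x
      using K_range[OF proj_in[of x]] by (simp add: q_def bop_diff[OF K_bop])
    have "q (R (c *\<^sub>C x - q (T x))) = x" if x: "x \<in> ?N" for x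
    proof -
      have "c *\<^sub>C x - q (T x) = q (c *\<^sub>C x - K x)"
        by (simp add: bop_diff[OF q_bop] bop_scaleC[OF q_bop] qK q_fixed[OF x])
      then show ?thesis
        by (simp add: qRq R(2) q_fixed[OF x])
    qed
    moreover have "c *\<^sub>C q (R x) - q (T (q (R x))) = x" if x: "x \<in> ?N" for x
    proof -
      have "c *\<^sub>C q (R x) - q (T (q (R x))) = q (c *\<^sub>C R x - K (R x))"
        by (simp add: bop_diff[OF q_bop] bop_scaleC[OF q_bop] Kq flip: qK)
      then show ?thesis
        by (simp add: R(3) q_fixed[OF x])
    qed
    moreover have "(\<lambda>x. c *\<^sub>C x - (q \<circ> T) x) \<in> bop ?N ?N"
      by (intro bop_minus bop_scale bop_id in_bop T subspace_orth_compl)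
    ultimately show ?thesis
      unfolding invertible_op_def using in_bop[OF R(1)] by (auto intro!: bexI[of _ "q \<circ> R"])
  qed
  have "quasinilpotent ?N (q \<circ> T)"
    unfolding quasinilpotent_def spectrum_def using in_bop[OF T] inv by auto
  then show ?thesis
    by (simp add: comp_def q_def)
qed

end

text \<open>The weighted definition controls \<open>F W\<close>, the quasinilpotent part of
  \<open>A W\<close>. The one of \<open>W A\<close> is \<open>W F\<close>, reached by exchanging the
  factors.\<close>

lemma wgdrazin_imp_gdrazin:
  fixes W :: "'y::chilbert_space \<Rightarrow> 'x::chilbert_space"
  assumes W: "W \<in> bop UNIV UNIV" and A: "A \<in> bop UNIV UNIV" and D: "is_wgdrazin_inverse W A D"
  shows "is_gdrazin_inverse (A \<circ> W) (D \<circ> W)" "is_gdrazin_inverse (W \<circ> A) (W \<circ> D)"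
proof -
  have D_bop: "D \<in> bop UNIV UNIV"
    using D by (simp add: is_wgdrazin_inverse_def)
  have comm: "A (W (D x)) = D (W (A x))" and absorb: "D (W (A (W (D x)))) = D x" for x
    using D by (auto simp: is_wgdrazin_inverse_def fun_eq_iff)
  define F where "F x = A x - (A \<circ> (W \<circ> (D \<circ> (W \<circ> A)))) x" for x
  have F: "F \<in> bop UNIV UNIV"
    unfolding F_def
    by (intro bop_minus A complex_vector.subspace_UNIV bop_comp[OF _ A] bop_comp[OF _ W]
        bop_comp[OF _ D_bop])
  have FW: "quasinilpotent UNIV (F \<circ> W)"
    using D by (simp add: is_wgdrazin_inverse_def F_def comp_def)
  then have "quasinilpotent UNIV (\<lambda>y. (A \<circ> W) y - (A \<circ> W) ((A \<circ> W) ((D \<circ> W) y)))"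
    by (simp add: F_def comp_def comm)
  then show "is_gdrazin_inverse (A \<circ> W) (D \<circ> W)"
    unfolding is_gdrazin_inverse_def using bop_comp[OF W D_bop]
    by (simp add: fun_eq_iff comm absorb[unfolded comm])
  have "quasinilpotent UNIV (W \<circ> F)"
    by (rule quasinilpotent_comp_commute[OF F W FW])
  then have "quasinilpotent UNIV (\<lambda>x. (W \<circ> A) x - (W \<circ> A) ((W \<circ> A) ((W \<circ> D) x)))"
    by (simp add: F_def comp_def comm bop_diff[OF W])
  then show "is_gdrazin_inverse (W \<circ> A) (W \<circ> D)"
    unfolding is_gdrazin_inverse_def using bop_comp[OF D_bop W]
    by (simp add: fun_eq_iff comm absorb[unfolded comm])
qed


section \<open>Operator matrices\<close>

lemma block_matrix_upper_apply:
  assumes m: "block_matrix L1 L2 M1 M2 F F1 F2 (\<lambda>_. 0) F3"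
  shows block_matrix_upper_left: "x \<in> L1 \<Longrightarrow> F x = F1 x"
    and block_matrix_upper_right: "x \<in> L2 \<Longrightarrow> F x = F2 x + F3 x"
proof -
  have "complex_vector.subspace L1" "complex_vector.subspace L2"
    using m by (simp_all add: block_matrix_def orth_sum_def)
  then have 0: "0 \<in> L1" "0 \<in> L2"
    by (simp_all add: complex_vector.subspace_0)
  have bop: "F1 \<in> bop L1 M1" "F2 \<in> bop L2 M1" "F3 \<in> bop L2 M2"
    and F: "\<And>x y. x \<in> L1 \<Longrightarrow> y \<in> L2 \<Longrightarrow> F (x + y) = F1 x + (F2 y + F3 y)"
    using m by (auto simp: block_matrix_def add.assoc)
  show "F x = F1 x" if "x \<in> L1"
    using F[OF that 0(2)] bop 0 by (simp add: bop_zero)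
  show "F x = F2 x + F3 x" if "x \<in> L2"
    using F[OF 0(1) that] bop 0 by (simp add: bop_zero)
qed

text \<open>The corner \<open>F1\<close> is a separate parameter agreeing with \<open>F\<close> on
  \<open>L\<close>, so that the matrix of \<open>B\<close> can carry \<open>A\<close> itself as its
  corner.\<close>

lemma block_matrix_upperI:
  fixes F :: "'a::chilbert_space \<Rightarrow> 'b::chilbert_space"
  assumes F: "F \<in> bop UNIV UNIV" and eq: "\<And>x. x \<in> L \<Longrightarrow> F x = F1 x"
    and F1: "\<And>x. x \<in> L \<Longrightarrow> F1 x \<in> M"
    and L: "complex_vector.subspace L" "closed L" and M: "complex_vector.subspace M" "closed M"
  shows "block_matrix L (orth_compl L) M (orth_compl M) F F1
    (orth_proj M \<circ> F) (\<lambda>_. 0) (\<lambda>x. F x - orth_proj M (F x))"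
proof -
  have p: "orth_proj M \<in> bop UNIV UNIV"
    by (rule bop_restrict[OF orth_proj_bop[OF M]]) auto
  have "F1 \<in> bop L M"
    using bop_cong[of L F F1 M] bop_restrict[OF F, of L M] eq F1 L(1) by auto
  moreover have "orth_proj M \<circ> F \<in> bop (orth_compl L) M"
    by (rule bop_restrict[OF bop_comp[OF F orth_proj_bop[OF M]]]) (auto simp: orth_proj_in[OF M])
  moreover have "(\<lambda>_. 0) \<in> bop L (orth_compl M)"
    by (rule bopI[where K = 0])
      (auto simp: complex_vector.subspace_0[OF subspace_orth_compl] scaleC_zero_right)
  moreover have "(\<lambda>x. F x - (orth_proj M \<circ> F) x) \<in> bop (orth_compl L) (orth_compl M)"
    by (rule bop_restrict[OF bop_minus[OF F bop_comp[OF F p]]])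
      (auto simp: orth_proj_residual[OF M])
  moreover have "F (x + y) = F1 x + orth_proj M (F y) + (0 + (F y - orth_proj M (F y)))"
    if "x \<in> L" for x y
    using eq[OF that] by (simp add: bop_add[OF F])
  ultimately show ?thesis
    unfolding block_matrix_def using orth_sum_orth_compl[OF L] orth_sum_orth_compl[OF M] by simp
qed

section \<open>Weighted inverses and the block form of the weak group relation\<close>

locale wgdrazin_pair =
  fixes W :: "'y::chilbert_space \<Rightarrow> 'x::chilbert_space" and A D :: "'x \<Rightarrow> 'y"
  assumes W: "W \<in> bop UNIV UNIV" and A: "A \<in> bop UNIV UNIV" and D: "is_wgdrazin_inverse W A D"
begin

sublocale Y: gdrazin_pair "A \<circ> W" "D \<circ> W"
  by unfold_locales (rule bop_comp[OF W A], rule wgdrazin_imp_gdrazin[OF W A D])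

sublocale X: gdrazin_pair "W \<circ> A" "W \<circ> D"
  by unfold_locales (rule bop_comp[OF A W], rule wgdrazin_imp_gdrazin[OF W A D])

abbreviation "MX \<equiv> range (W \<circ> D)"
abbreviation "MY \<equiv> range (D \<circ> W)"
abbreviation "NX \<equiv> orth_compl MX"
abbreviation "NY \<equiv> orth_compl MY"

lemma D_bop: "D \<in> bop UNIV UNIV"
  using D by (simp add: is_wgdrazin_inverse_def)

lemma D_commute: "A (W (D x)) = D (W (A x))"
  using D by (auto simp: is_wgdrazin_inverse_def fun_eq_iff)

lemma A_range: "x \<in> MX \<Longrightarrow> A x \<in> MY"
  by (auto simp: D_commute)

lemma W_range: "y \<in> MY \<Longrightarrow> W y \<in> MX"
  by auto

lemma A_invertible: "invertible_op MX MY A"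
  unfolding invertible_op_def
proof (intro conjI bexI[of _ "W \<circ> (D \<circ> W)"] ballI)
  show "A \<in> bop MX MY"
    by (rule bop_restrict[OF A]) (auto intro: A_range[simplified])
  show "W \<circ> (D \<circ> W) \<in> bop MY MX"
    by (rule bop_restrict[OF bop_comp[OF bop_comp[OF W D_bop] W]]) auto
  show "(W \<circ> (D \<circ> W)) (A x) = x" if "x \<in> MX" for x
    using X.S_T_range[OF that] by simp
  show "A ((W \<circ> (D \<circ> W)) y) = y" if "y \<in> MY" for y
    using Y.S_T_range[OF that] by (simp add: D_commute)
qed

lemma W_invertible: "invertible_op MY MX W"
  unfolding invertible_op_def
proof (intro conjI bexI[of _ "A \<circ> (W \<circ> D)"] ballI)
  show "W \<in> bop MY MX"
    by (rule bop_restrict[OF W]) auto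
  show "A \<circ> (W \<circ> D) \<in> bop MX MY"
    by (rule bop_restrict[OF bop_comp[OF bop_comp[OF D_bop W] A]]) (auto simp: D_commute)
  show "(A \<circ> (W \<circ> D)) (W y) = y" if "y \<in> MY" for y
    using Y.S_T_range[OF that] by (simp add: D_commute)
  show "W ((A \<circ> (W \<circ> D)) x) = x" if "x \<in> MX" for x
    using X.S_T_range[OF that] by (simp add: D_commute)
qed

text \<open>The entries are arbitrary, so the equivalence serves both directions of the theorem.
  \<open>A W y - B W y\<close> splits into \<open>v\<close> in \<open>MY\<close> and
  \<open>u\<close> in \<open>NY\<close>, and \<open>t\<close> is the upper right entry of
  \<open>A W\<close> applied to \<open>u\<close>.\<close>

lemma block_condition_iff:
  assumes MA: "block_matrix MX NX MY NY A A1 A2 (\<lambda>_. 0) A3"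
    and MW: "block_matrix MY NY MX NX W W1 W2 (\<lambda>_. 0) W3"
    and MB: "block_matrix MX NX MY NY B A1 B2 (\<lambda>_. 0) B3"
    and B: "B \<in> bop UNIV UNIV" and y: "y \<in> NY"
  shows "(A2 (W3 y) - B2 (W3 y)) +
        inv_into MY (A1 \<circ> W1)
          ((A1 \<circ> W2) (A3 (W3 y) - B3 (W3 y)) + (A2 \<circ> W3) (A3 (W3 y) - B3 (W3 y))) = 0
    \<longleftrightarrow> orth_proj MY (A (W (A (W y) - B (W y)))) = 0"
proof -
  note Aa = block_matrix_upper_apply[OF MA]
    and Wa = block_matrix_upper_apply[OF MW]
    and Ba = block_matrix_upper_apply[OF MB]
  have A1: "A1 \<in> bop MX MY" and A2: "A2 \<in> bop NX MY" and A3: "A3 \<in> bop NX NY"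
    using MA by (simp_all add: block_matrix_def)
  have W2: "W2 \<in> bop NY MX" and W3: "W3 \<in> bop NY NX"
    using MW by (simp_all add: block_matrix_def)
  have B2: "B2 \<in> bop NX MY" and B3: "B3 \<in> bop NX NY"
    using MB by (simp_all add: block_matrix_def)
  define v where "v = A2 (W3 y) - B2 (W3 y)"
  define u where "u = A3 (W3 y) - B3 (W3 y)"
  define t where "t = A1 (W2 u) + A2 (W3 u)"
  have W3y: "W3 y \<in> NX" and W2y: "W2 y \<in> MX"
    using y W2 W3 by (auto intro: bop_in)
  have v: "v \<in> MY"
    unfolding v_def using W3y A2 B2
    by (intro complex_vector.subspace_diff[OF Y.subspace_range]) (auto intro: bop_in)
  have u: "u \<in> NY"
    unfolding u_def using W3y A3 B3
    by (intro complex_vector.subspace_diff[OF subspace_orth_compl]) (auto intro: bop_in)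
  have W3u: "W3 u \<in> NX" and W2u: "W2 u \<in> MX"
    using u W2 W3 by (auto intro: bop_in)
  have t: "t \<in> MY"
    unfolding t_def using W3u W2u A1 A2
    by (intro complex_vector.subspace_add[OF Y.subspace_range]) (auto intro: bop_in)
  \<comment> \<open>On \<open>MY\<close> the corner product coincides with \<open>A W\<close>, whose
    inverse there is \<open>D W\<close>; this identifies the value of \<open>inv_into\<close> at
    \<open>t\<close>.\<close>
  have AW1: "(A1 \<circ> W1) z = (A \<circ> W) z" if "z \<in> MY" for z
    using that Aa(1)[OF W_range[OF that]] Wa(1)[OF that] by simp
  have "inj_on (A1 \<circ> W1) MY"
    using AW1 Y.S_T_range by (metis inj_onI)
  moreover have "(D \<circ> W) t \<in> MY"
    by blast
  moreover have "(A1 \<circ> W1) ((D \<circ> W) t) = t"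
    unfolding AW1[OF rangeI] Y.commute by (rule Y.S_T_range[OF t])
  ultimately have inv: "inv_into MY (A1 \<circ> W1) t = (D \<circ> W) t"
    by (rule inv_into_f_eq)
  have AWv: "(A \<circ> W) v \<in> MY"
    by (rule Y.T_range[OF v])
  have sum: "(A \<circ> W) v + t \<in> MY"
    by (rule complex_vector.subspace_add[OF Y.subspace_range AWv t])
  \<comment> \<open>Since \<open>D W\<close> inverts \<open>A W\<close> on \<open>MY\<close>, it can
    be factored out of the sum, and its injectivity on \<open>MY\<close> lets it be dropped.\<close>
  have "v + (D \<circ> W) t = (D \<circ> W) ((A \<circ> W) v + t)"
    using Y.S_T_range[OF v] by (simp only: bop_add[OF Y.S UNIV_I UNIV_I])
  then have "v + (D \<circ> W) t = 0 \<longleftrightarrow> (A \<circ> W) v + t = 0"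
    by (metis Y.S_T_range[OF sum] Y.commute bop_zero[OF Y.S UNIV_I] bop_zero[OF Y.T UNIV_I])
  also have "(A \<circ> W) v + t = orth_proj MY (A (W (A (W y) - B (W y))))"
  proof -
    have A_Wy: "A (W y) = A1 (W2 y) + (A2 (W3 y) + A3 (W3 y))"
      by (simp add: Wa(2)[OF y] bop_add[OF A] Aa(1)[OF W2y] Aa(2)[OF W3y])
    have B_Wy: "B (W y) = A1 (W2 y) + (B2 (W3 y) + B3 (W3 y))"
      by (simp add: Wa(2)[OF y] bop_add[OF B] Ba(1)[OF W2y] Ba(2)[OF W3y])
    \<comment> \<open>The terms with \<open>W2 y\<close> cancel because \<open>A\<close> and
      \<open>B\<close> share the corner \<open>A1\<close>.\<close>
    have "A (W y) - B (W y) = v + u"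
      by (simp add: A_Wy B_Wy v_def u_def)
    moreover have "A (W u) = t + A3 (W3 u)"
      by (simp add: Wa(2)[OF u] bop_add[OF A] Aa(1)[OF W2u] Aa(2)[OF W3u] t_def add.assoc)
    ultimately have "A (W (A (W y) - B (W y))) = ((A \<circ> W) v + t) + A3 (W3 u)"
      by (simp add: bop_add[OF A] bop_add[OF W] add.assoc)
    moreover have "orth_proj MY (A3 (W3 u)) = 0"
      by (rule Y.proj_orth_compl[OF bop_in[OF A3 W3u]])
    ultimately show ?thesis
      by (simp only: bop_add[OF Y.proj_bop UNIV_I UNIV_I] Y.proj_fixed[OF AWv]
          Y.proj_fixed[OF t] add_0_right)
  qed
  finally have "v + inv_into MY (A1 \<circ> W1) t = 0
      \<longleftrightarrow> orth_proj MY (A (W (A (W y) - B (W y)))) = 0"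
    unfolding inv .
  then show ?thesis
    by (simp only: v_def u_def t_def comp_apply)
qed

lemma weak_group_condition_iff_block:
  assumes B: "B \<in> bop UNIV UNIV"
  shows "A \<circ> W \<circ> weak_group (A \<circ> W) = B \<circ> W \<circ> weak_group (A \<circ> W) \<and>
      weak_group (A \<circ> W) \<circ> (A \<circ> W) = weak_group (A \<circ> W) \<circ> (B \<circ> W) \<longleftrightarrow>
    (\<exists>A1 A2 A3 W1 W2 W3 B2 B3.
      block_matrix MX NX MY NY A A1 A2 (\<lambda>_. 0) A3 \<and>
      block_matrix MY NY MX NX W W1 W2 (\<lambda>_. 0) W3 \<and>
      block_matrix MX NX MY NY B A1 B2 (\<lambda>_. 0) B3 \<and>
      invertible_op MX MY A1 \<and> invertible_op MY MX W1 \<and>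
      (\<forall>y\<in>NY. (A2 (W3 y) - B2 (W3 y)) +
        inv_into MY (A1 \<circ> W1)
          ((A1 \<circ> W2) (A3 (W3 y) - B3 (W3 y)) + (A2 \<circ> W3) (A3 (W3 y) - B3 (W3 y))) = 0) \<and>
      quasinilpotent NY (A3 \<circ> W3) \<and> quasinilpotent NX (W3 \<circ> A3))"
    (is "?weak \<longleftrightarrow> ?block")
proof -
  have weak: "?weak \<longleftrightarrow> (\<forall>y\<in>MY. B (W y) = A (W y)) \<and>
      (\<forall>y\<in>NY. orth_proj MY (A (W (A (W y) - B (W y)))) = 0)"
    using Y.weak_group_eqs_iff[OF bop_comp[OF W B]] by (simp only: comp_apply)
  show ?thesis
  proof
    assume "?weak"
    then have eq: "\<And>y. y \<in> MY \<Longrightarrow> B (W y) = A (W y)"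
      and cond: "\<And>y. y \<in> NY \<Longrightarrow> orth_proj MY (A (W (A (W y) - B (W y)))) = 0"
      unfolding weak by blast+
    \<comment> \<open>The hypothesis gives equality only on the image of \<open>MY\<close> under
      \<open>W\<close>; this image is all of \<open>MX\<close>, with \<open>A (W (D x))\<close> a
      preimage of \<open>x\<close>.\<close>
    have BA: "B x = A x" if "x \<in> MX" for x
    proof -
      have "W (A (W (D x))) = x"
        using X.S_T_range[OF that] by (simp add: D_commute)
      then show ?thesis
        using eq[of "A (W (D x))"] by (simp add: D_commute)
    qed
    note blockI = block_matrix_upperI[OF _ _ _ X.subspace_range X.closed_range
        Y.subspace_range Y.closed_range]
    have MA: "block_matrix MX NX MY NY A A (orth_proj MY \<circ> A) (\<lambda>_. 0) (\<lambda>x. A x - orth_proj MY (A x))"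
      by (rule blockI[OF A refl A_range])
    have MB: "block_matrix MX NX MY NY B A (orth_proj MY \<circ> B) (\<lambda>_. 0) (\<lambda>x. B x - orth_proj MY (B x))"
      by (rule blockI[OF B BA A_range])
    have MW: "block_matrix MY NY MX NX W W (orth_proj MX \<circ> W) (\<lambda>_. 0) (\<lambda>x. W x - orth_proj MX (W x))"
      by (rule block_matrix_upperI[OF W refl W_range Y.subspace_range Y.closed_range
            X.subspace_range X.closed_range])
    \<comment> \<open>\<open>A\<close> maps the subtracted part in \<open>MX\<close> into
      \<open>MY\<close>, where the residual vanishes. So the product of the lower right entries is
      the compression of \<open>A W\<close>.\<close>
    have QY: "quasinilpotent NY ((\<lambda>x. A x - orth_proj MY (A x)) \<circ> (\<lambda>y. W y - orth_proj MX (W y)))"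
    proof -
      have "A (W y - orth_proj MX (W y)) - orth_proj MY (A (W y - orth_proj MX (W y)))
          = A (W y) - orth_proj MY (A (W y))" for y
        by (simp only: bop_diff[OF A] bop_diff[OF Y.proj_bop] Y.proj_fixed[OF A_range[OF X.proj_in]])
          simp
      then show ?thesis
        using Y.quasinilpotent_compression by (simp add: comp_def)
    qed
    have QX: "quasinilpotent NX ((\<lambda>y. W y - orth_proj MX (W y)) \<circ> (\<lambda>x. A x - orth_proj MY (A x)))"
    proof -
      have "W (A x - orth_proj MY (A x)) - orth_proj MX (W (A x - orth_proj MY (A x)))
          = W (A x) - orth_proj MX (W (A x))" for x
        by (simp only: bop_diff[OF W] bop_diff[OF X.proj_bop] X.proj_fixed[OF W_range[OF Y.proj_in]])
          simp
      then show ?thesis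
        using X.quasinilpotent_compression by (simp add: comp_def)
    qed
    show ?block
      by (intro exI conjI)
        (rule MA MW MB A_invertible W_invertible QY QX
          ballI[OF iffD2[OF block_condition_iff[OF MA MW MB B] cond]]; assumption?)+
  next
    assume ?block
    then obtain A1 A2 A3 W1 W2 W3 B2 B3 where
      MA: "block_matrix MX NX MY NY A A1 A2 (\<lambda>_. 0) A3" and
      MW: "block_matrix MY NY MX NX W W1 W2 (\<lambda>_. 0) W3" and
      MB: "block_matrix MX NX MY NY B A1 B2 (\<lambda>_. 0) B3" and
      cond: "\<forall>y\<in>NY. (A2 (W3 y) - B2 (W3 y)) +
        inv_into MY (A1 \<circ> W1)
          ((A1 \<circ> W2) (A3 (W3 y) - B3 (W3 y)) + (A2 \<circ> W3) (A3 (W3 y) - B3 (W3 y))) = 0"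
      by blast
    have "B (W y) = A (W y)" if "y \<in> MY" for y
      using block_matrix_upper_left[OF MA W_range[OF that]]
        block_matrix_upper_left[OF MB W_range[OF that]] by simp
    moreover have "orth_proj MY (A (W (A (W y) - B (W y)))) = 0" if "y \<in> NY" for y
      using cond that block_condition_iff[OF MA MW MB B that] by blast
    ultimately show ?weak
      unfolding weak by blast
  qed
qed

end

theorem theorem3p1:
  fixes W :: "'y::chilbert_space \<Rightarrow> 'x::chilbert_space"
    and A B :: "'x \<Rightarrow> 'y"
  assumes infdim_X: "\<And>S :: 'x set. finite S \<Longrightarrow> complex_vector.span S \<noteq> UNIV"
    and infdim_Y: "\<And>S :: 'y set. finite S \<Longrightarrow> complex_vector.span S \<noteq> UNIV"
    and W: "W \<in> bop UNIV UNIV" and W_nonzero: "W \<noteq> (\<lambda>_. 0)"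
    and A: "A \<in> bop UNIV UNIV" and A_inv: "wgdrazin_invertible W A"
    and B: "B \<in> bop UNIV UNIV"
  shows "(weak_group_rel_r W A B \<longleftrightarrow>
           A \<circ> W \<circ> weak_group (A \<circ> W) = B \<circ> W \<circ> weak_group (A \<circ> W) \<and>
           weak_group (A \<circ> W) \<circ> (A \<circ> W) = weak_group (A \<circ> W) \<circ> (B \<circ> W))
       \<and> (weak_group_rel_r W A B \<longleftrightarrow>
           (let RX = range (gdrazin (W \<circ> A)); NX = null_space (cadjoint (gdrazin (W \<circ> A)));
                RY = range (gdrazin (A \<circ> W)); NY = null_space (cadjoint (gdrazin (A \<circ> W)))
            in \<exists>A1 A2 A3 W1 W2 W3 B2 B3.
                 block_matrix RX NX RY NY A A1 A2 (\<lambda>_. 0) A3 \<and>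
                 block_matrix RY NY RX NX W W1 W2 (\<lambda>_. 0) W3 \<and>
                 block_matrix RX NX RY NY B A1 B2 (\<lambda>_. 0) B3 \<and>
                 invertible_op RX RY A1 \<and> invertible_op RY RX W1 \<and>
                 (\<forall>y\<in>NY. (A2 (W3 y) - B2 (W3 y)) +
                    inv_into RY (A1 \<circ> W1)
                      ((A1 \<circ> W2) (A3 (W3 y) - B3 (W3 y)) + (A2 \<circ> W3) (A3 (W3 y) - B3 (W3 y))) = 0) \<and>
                 quasinilpotent NY (A3 \<circ> W3) \<and> quasinilpotent NX (W3 \<circ> A3)))"
proof -
  obtain D where D: "is_wgdrazin_inverse W A D"
    using A_inv by (auto simp: wgdrazin_invertible_def)
  interpret wgdrazin_pair W A D
    by unfold_locales (fact W A D)+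
  have "gdrazin_invertible (A \<circ> W)"
    using Y.T Y.inverse by (auto simp: gdrazin_invertible_def)
  \<comment> \<open>The remaining clauses of the relation hold by the assumptions, so statement (i)
    reduces to the two equations of (ii).\<close>
  then have rel: "weak_group_rel_r W A B \<longleftrightarrow>
      A \<circ> W \<circ> weak_group (A \<circ> W) = B \<circ> W \<circ> weak_group (A \<circ> W) \<and>
      weak_group (A \<circ> W) \<circ> (A \<circ> W) = weak_group (A \<circ> W) \<circ> (B \<circ> W)"
    using A_inv B bop_comp[OF W B] by (simp add: weak_group_rel_r_def weak_group_rel_def)
  have NX: "null_space (cadjoint (W \<circ> D)) = NX" and NY: "null_space (cadjoint (D \<circ> W)) = NY"
    by (simp_all only: null_space_cadjoint[OF X.S] null_space_cadjoint[OF Y.S] orth_compl_def)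
  show ?thesis
    unfolding Let_def X.gdrazin_eq Y.gdrazin_eq NX NY rel
    using weak_group_condition_iff_block[OF B] by (intro conjI refl)
qed

end
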